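(* Let $n\ge 1$, let $P\in\mathscr{P}_n$ be a polynomial which does not vanish in $|z|<1$, let $B\in\mathcal{B}_n$ have parameters $\lambda_0,\lambda_1,\lambda_2$, and put $m=\min_{|z|=1}|P(z)|$. Then for all $\alpha,\delta\in\mathbb{C}$ with $|\alpha|\le 1$, $|\delta|\le 1$, all $0\le p<\infty$ and all $R>1$, with $\sigma(z)=Rz$, $$\left\|B[P\circ\sigma](z)-\alpha B[P](z)+\delta\left\{\frac{\left(|R^n-\alpha||\Lambda_n|-|1-\alpha||\lambda_0|\right)m}{2}\right\}\right\|_p\le\frac{\left\|(R^n-\alpha)\Lambda_n z+(1-\alpha)\lambda_0\right\|_p}{\|1+z\|_p}\,\|P(z)\|_p .$$ The result is best possible: equality holds for $P(z)=az^n+b$ with $|a|=|b|=1$.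
   Context: $\mathscr{P}_n$ is the space of complex polynomials of degree at most $n$. For a polynomial $Q$, define $\|Q(z)\|_0:=\exp\left\{\frac1{2\pi}\int_0^{2\pi}\log|Q(e^{i\theta})|\,d\theta\right\}$ and, for $0<p<\infty$, $\|Q(z)\|_p:=\left\{\frac1{2\pi}\int_0^{2\pi}|Q(e^{i\theta})|^p\,d\theta\right\}^{1/p}$. $P\circ\sigma$ denotes the composite $(P\circ\sigma)(z)=P(\sigma(z))$. The class $\mathcal{B}_n$ consists of the operators $B$ carrying $P\in\mathscr{P}_n$ into $$B[P](z):=\lambda_0P(z)+\lambda_1\left(\frac{nz}{2}\right)\frac{P'(z)}{1!}+\lambda_2\left(\frac{nz}{2}\right)^2\frac{P''(z)}{2!},$$ where $\lambda_0,\lambda_1,\lambda_2\in\mathbb{C}$ are such that all the zeros of $U(z):=\lambda_0+\lambda_1\binom n1 z+\lambda_2\binom n2 z^2$ lie in the half plane $|z|\le|z-n/2|$. Also $\Lambda_n:=\lambda_0+\lambda_1\frac{n^2}{2}+\lambda_2\frac{n^3(n-1)}{8}$. *)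

theory Defs
  imports "HOL-Analysis.Analysis" "HOL-Computational_Algebra.Polynomial"
begin

text \<open>
  The case \<open>p = 0\<close> is the geometric mean of \<open>\<bar>Q\<bar>\<close> over the unit circle. The zero polynomial is
  treated separately, because there the intended value is \<open>exp (- \<infinity>) = 0\<close>, whereas
  \<open>ln 0 = 0\<close> in HOL. For \<open>Q \<noteq> 0\<close> the function \<open>\<theta> \<mapsto> ln \<bar>Q (cis \<theta>)\<bar>\<close> is Lebesgue integrable on
  \<open>{0..2 * pi}\<close> and the finitely many zeros of \<open>Q\<close> on the circle do not affect the integral.
\<close>

definition circle_norm :: "real \<Rightarrow> complex poly \<Rightarrow> real" where
  "circle_norm p Q =
     (if p = 0 then
        (if Q = 0 then 0
         else exp (1 / (2 * pi) * (LINT \<theta>:{0..2 * pi}|lborel. ln (cmod (poly Q (cis \<theta>))))))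
      else (1 / (2 * pi) * (LINT \<theta>:{0..2 * pi}|lborel. cmod (poly Q (cis \<theta>)) powr p)) powr (1 / p))"

text \<open>The infimum is attained, since the unit circle is compact.\<close>

definition circle_min :: "complex poly \<Rightarrow> real" where
  "circle_min P = (INF z\<in>sphere 0 1. cmod (poly P z))"

definition char_poly_B :: "nat \<Rightarrow> complex \<Rightarrow> complex \<Rightarrow> complex \<Rightarrow> complex poly" where
  "char_poly_B n l0 l1 l2 = [:l0, l1 * of_nat (n choose 1), l2 * of_nat (n choose 2):]"

definition admissible_B :: "nat \<Rightarrow> complex \<Rightarrow> complex \<Rightarrow> complex \<Rightarrow> bool" where
  "admissible_B n l0 l1 l2 \<longleftrightarrow>
     (\<forall>z. poly (char_poly_B n l0 l1 l2) z = 0 \<longrightarrow> cmod z \<le> cmod (z - of_nat n / 2))"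

text \<open>In the following definition, \<open>[:0, of_nat n / 2:]\<close> is the polynomial \<open>n z / 2\<close>.\<close>

definition op_B :: "nat \<Rightarrow> complex \<Rightarrow> complex \<Rightarrow> complex \<Rightarrow> complex poly \<Rightarrow> complex poly" where
  "op_B n l0 l1 l2 P =
     smult l0 P
     + smult (l1 / fact 1) ([:0, of_nat n / 2:] * pderiv P)
     + smult (l2 / fact 2) ([:0, of_nat n / 2:] ^ 2 * pderiv (pderiv P))"

definition Lambda_B :: "nat \<Rightarrow> complex \<Rightarrow> complex \<Rightarrow> complex \<Rightarrow> complex" where
  "Lambda_B n l0 l1 l2 =
     l0 + l1 * (of_nat n ^ 2 / 2) + l2 * (of_nat n ^ 3 * (of_nat n - 1) / 8)"

end

theory Submission
  imports Defs "HOL-Complex_Analysis.Conformal_Mappings"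
    "HOL-Computational_Algebra.Fundamental_Theorem_Algebra"
    "HOL-Probability.Probability_Measure" "HOL-Real_Asymp.Real_Asymp"
begin

text \<open>
  The operator \<open>L : P \<mapsto> B[P \<circ> \<sigma>] - \<alpha> B[P]\<close> is diagonal on monomials, with multipliers
  \<open>\<nu> k = \<mu> k * (R ^ k - \<alpha>)\<close>, where \<open>\<mu> k\<close> are the multipliers of \<open>B\<close>; in particular \<open>\<nu> 0 = (1 - \<alpha>) * \<lambda>\<^sub>0\<close> and
  \<open>\<nu> n = (R ^ n - \<alpha>) * \<Lambda>\<close>. Its dual \<open>L\<^sup>*\<close>, with multipliers \<open>cnj (\<nu> (n - k))\<close>, is \<open>L\<close> conjugated by
  \<open>P \<mapsto> z ^ n * cnj (P (1 / cnj z))\<close>. The proof rests on one fact: \<open>L\<^sup>*\<close> maps polynomials of degree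
  at most \<open>n\<close> without zeros in the open disc to polynomials of the same kind. For the factor \<open>R ^ k - \<alpha>\<close>
  this is the strict growth of such polynomials under dilation
  (\<open>preserves_zero_free_dilation_diff\<close>). For \<open>\<mu> k\<close> it is Laguerre's theorem, because the dual of \<open>B\<close>
  is at each point a product of two polar derivatives (one if \<open>n = 1\<close>), and the half plane condition on \<open>\<lambda>\<^sub>0, \<lambda>\<^sub>1, \<lambda>\<^sub>2\<close> says
  exactly that their poles lie in the disc (\<open>preserves_zero_free_mult_B\<close>).

  Consequently \<open>\<bar>L P\<bar> \<le> \<bar>L\<^sup>* P\<bar>\<close> on the closed disc. Applied to \<open>P + b\<close> with \<open>\<bar>b\<bar> < m\<close> this improves to
  \<open>\<bar>L P\<bar> + (\<bar>\<nu> n\<bar> - \<bar>\<nu> 0\<bar>) * m \<le> \<bar>L\<^sup>* P\<bar>\<close> (\<open>diag_op_add_min_le_dual\<close>), so the polynomial \<open>W\<close> on the left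
  of the theorem satisfies \<open>2 * \<bar>W\<bar> \<le> \<bar>L P\<bar> + \<bar>L\<^sup>* P\<bar>\<close> on the circle. For \<open>\<bar>u\<bar> = 1\<close> it follows that
  \<open>\<bar>W\<bar> * \<bar>1 + u\<bar>\<close> is at most the modulus of \<open>\<bar>L P\<bar> + u * \<bar>L\<^sup>* P\<bar>\<close>. Raising this to the power \<open>p\<close> and integrating over
  \<open>u\<close> and over \<open>z\<close>, the left side becomes the product of the norms of \<open>W\<close> and of \<open>1 + z\<close>, and the right
  side becomes the double integral of \<open>\<bar>L P + u * L\<^sup>* P\<bar>\<close> to the power \<open>p\<close>. The operator \<open>L + u * L\<^sup>*\<close> again
  keeps the disc free of zeros, unless it is zero (\<open>diag_op_add_dual_zero_free\<close>), so Arestov's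
  inequality bounds the integral over \<open>z\<close> by \<open>\<bar>\<nu> 0 + u * cnj (\<nu> n)\<bar>\<close> to the power \<open>p\<close> times that of \<open>P\<close>, and integrating
  over \<open>u\<close> completes the estimate (\<open>powr_integral_mean_le\<close>). For \<open>p = 0\<close> Jensen's
  formula for \<open>L\<^sup>* P\<close> suffices.

  Arestov's inequality is proved for Mahler measures first: reflecting the roots of a polynomial in the circle
  leads to the case without zeros, where Jensen's formula reads off the constant terms. Adding
  \<open>s * u\<close> to the polynomial and averaging over \<open>u\<close> turns \<open>ln \<bar>P\<bar>\<close> into \<open>ln (max \<bar>P\<bar> s)\<close>, and the powers
  \<open>\<bar>P\<bar> powr p\<close> are superpositions of these. Jensen's formula in turn comes from the invariance
  of arc length under \<open>z \<mapsto> z\<^sup>2\<close>.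

  For \<open>a z ^ n + b\<close> with unimodular coefficients, \<open>m = 0\<close> and the images are again binomials, whose norms do
  not depend on \<open>n\<close> or on the arguments of the coefficients; this gives equality.
\<close>

section \<open>Polynomials without zeros in the open unit disc\<close>

text \<open>
  Splitting off one root at a time lowers the degree bound in step with the degree, and the bound
  at a constant is arbitrary. So properties that count missing roots as roots at infinity can be
  proved without ever asking for the exact degree.
\<close>

lemma poly_root_induct_le [consumes 2, case_names const factor]:
  fixes f :: "complex poly"
  assumes "degree f \<le> n" and "f \<noteq> 0"
    and const: "\<And>n c. c \<noteq> 0 \<Longrightarrow> Q n [:c:]"
    and factor: "\<And>n r g. degree g \<le> n \<Longrightarrow> g \<noteq> 0 \<Longrightarrow> Q n g \<Longrightarrow> Q (Suc n) ([:- r, 1:] * g)"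
  shows "Q n f"
  using assms(1,2)
proof (induction "degree f" arbitrary: f n)
  case 0
  then obtain c where "f = [:c:]" by (metis degree_eq_zeroE)
  with 0 show ?case by (auto intro: const)
next
  case (Suc d)
  have "\<not> constant (poly f)"
    using Suc.hyps(2) by (simp add: constant_degree)
  from Fundamental_Theorem_Algebra.fundamental_theorem_of_algebra[OF this] obtain r where "poly f r = 0" ..
  then obtain g where g: "f = [:- r, 1:] * g"
    unfolding poly_eq_0_iff_dvd by (rule dvdE)
  have g0: "g \<noteq> 0" using Suc.prems g by auto
  then have deg: "degree f = Suc (degree g)"
    unfolding g by (subst degree_mult_eq) auto
  obtain k where k: "n = Suc k" using Suc.prems deg by (cases n) auto
  have "Q k g"
    using Suc.hyps Suc.prems deg g0 k by auto
  then show ?case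
    unfolding g k using Suc.prems deg k g0 by (intro factor) auto
qed

text \<open>
  Only an upper bound on the degree is imposed: reversal with respect to \<open>n\<close> turns the roots
  missing from \<open>n\<close> into roots at \<open>0\<close>, so that a polynomial of this class is the reversal of a
  polynomial of exact degree \<open>n\<close> with all its roots in the closed disc.
\<close>

definition zero_free :: "nat \<Rightarrow> complex poly \<Rightarrow> bool" where
  "zero_free n f \<longleftrightarrow> degree f \<le> n \<and> (\<forall>z. cmod z < 1 \<longrightarrow> poly f z \<noteq> 0)"

lemma zero_freeD:
  assumes "zero_free n f"
  shows "degree f \<le> n" and "cmod z < 1 \<Longrightarrow> poly f z \<noteq> 0" and "f \<noteq> 0"
  using assms unfolding zero_free_def by (auto dest: spec[of _ 0])

lemma zero_free_const: "c \<noteq> 0 \<Longrightarrow> zero_free n [:c:]"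
  by (simp add: zero_free_def)

lemma zero_free_linear_factor_iff:
  assumes "g \<noteq> 0"
  shows "zero_free (Suc n) ([:- r, 1:] * g) \<longleftrightarrow> 1 \<le> cmod r \<and> zero_free n g"
proof -
  have "degree ([:- r, 1:] * g) = Suc (degree g)"
    using assms by (subst degree_mult_eq) auto
  then show ?thesis
    unfolding zero_free_def by (force simp: not_less)
qed

lemma zero_free_induct [consumes 1, case_names const factor]:
  assumes zf: "zero_free n f"
    and const: "\<And>n c. c \<noteq> 0 \<Longrightarrow> Q n [:c:]"
    and factor: "\<And>n r g. 1 \<le> cmod r \<Longrightarrow> zero_free n g \<Longrightarrow> Q n g \<Longrightarrow> Q (Suc n) ([:- r, 1:] * g)"
  shows "Q n f"
proof -
  have "zero_free n f \<longrightarrow> Q n f"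
    using zero_freeD(1,3)[OF zf]
  proof (induction rule: poly_root_induct_le)
    case (const n c)
    show ?case using assms(2)[OF const] by (rule impI)
  next
    case (factor n r g)
    show ?case
      unfolding zero_free_linear_factor_iff[OF factor(2)] using factor(3) assms(3) by blast
  qed
  from this zf show ?thesis by (rule mp)
qed

lemma poly_linear_factor_mult: "poly ([:- r, 1:] * g) z = (z - r) * poly g z" for r z :: complex
  by (simp add: algebra_simps)

lemma poly_pderiv_linear_factor_mult:
  "poly (pderiv ([:- r, 1:] * g)) z = poly g z + (z - r) * poly (pderiv g) z" for r z :: complex
  by (simp only: pderiv_mult) (simp add: pderiv_pCons algebra_simps)

lemma blaschke_identity:
  "(cmod (1 - cnj r * z))\<^sup>2 - (cmod (z - r))\<^sup>2 = (1 - (cmod r)\<^sup>2) * (1 - (cmod z)\<^sup>2)"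
  unfolding cmod_power2 by (simp add: power2_eq_square algebra_simps)

lemma disc_factor_le:
  assumes "cmod z \<le> 1" "1 \<le> cmod r"
  shows "cmod (1 - cnj r * z) \<le> cmod (z - r)"
proof -
  have "(1 - (cmod r)\<^sup>2) * (1 - (cmod z)\<^sup>2) \<le> 0"
    using assms by (intro mult_nonpos_nonneg) (auto simp: power_le_one)
  then have "(cmod (1 - cnj r * z))\<^sup>2 \<le> (cmod (z - r))\<^sup>2"
    using blaschke_identity[of r z] by linarith
  then show ?thesis by (rule power2_le_imp_le) simp
qed

lemma disc_factor_ge:
  assumes "cmod z \<le> 1" "cmod r \<le> 1"
  shows "cmod (z - r) \<le> cmod (1 - cnj r * z)"
proof -
  have "0 \<le> (1 - (cmod r)\<^sup>2) * (1 - (cmod z)\<^sup>2)"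
    using assms by (intro mult_nonneg_nonneg) (auto simp: power_le_one)
  then have "(cmod (z - r))\<^sup>2 \<le> (cmod (1 - cnj r * z))\<^sup>2"
    using blaschke_identity[of r z] by linarith
  then show ?thesis by (rule power2_le_imp_le) simp
qed

lemma disc_factor_circle:
  assumes "cmod z = 1"
  shows "cmod (1 - cnj r * z) = cmod (z - r)"
  using blaschke_identity[of r z] assms by simp

section \<open>Diagonal operators and conjugate reversal\<close>

definition diag_op :: "nat \<Rightarrow> (nat \<Rightarrow> complex) \<Rightarrow> complex poly \<Rightarrow> complex poly" where
  "diag_op n \<nu> f = (\<Sum>k\<le>n. monom (\<nu> k * coeff f k) k)"

text \<open>For \<open>z \<noteq> 0\<close> the value at \<open>z\<close> is \<open>z ^ n * cnj (poly f (1 / cnj z))\<close>.\<close>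

definition conj_reverse :: "nat \<Rightarrow> complex poly \<Rightarrow> complex poly" where
  "conj_reverse n f = (\<Sum>k\<le>n. monom (cnj (coeff f (n - k))) k)"

lemma coeff_diag_op: "coeff (diag_op n \<nu> f) k = (if k \<le> n then \<nu> k * coeff f k else 0)"
  by (simp add: diag_op_def coeff_sum sum.delta if_distrib cong: if_cong)

lemma coeff_conj_reverse:
  "coeff (conj_reverse n f) k = (if k \<le> n then cnj (coeff f (n - k)) else 0)"
  by (simp add: conj_reverse_def coeff_sum sum.delta if_distrib cong: if_cong)

lemma degree_diag_op: "degree (diag_op n \<nu> f) \<le> n"
  by (rule degree_le) (simp add: coeff_diag_op)

lemma degree_conj_reverse: "degree (conj_reverse n f) \<le> n"
  by (rule degree_le) (simp add: coeff_conj_reverse)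

lemma poly_diag_op: "poly (diag_op n \<nu> f) z = (\<Sum>k\<le>n. \<nu> k * coeff f k * z ^ k)"
  by (simp add: diag_op_def poly_sum poly_monom)

lemma diag_op_add: "diag_op n \<nu> (f + g) = diag_op n \<nu> f + diag_op n \<nu> g"
  by (rule poly_eqI) (simp add: coeff_diag_op algebra_simps)

lemma diag_op_smult: "diag_op n \<nu> (smult c f) = smult c (diag_op n \<nu> f)"
  by (rule poly_eqI) (simp add: coeff_diag_op)

lemma diag_op_const: "diag_op n \<nu> [:c:] = [:\<nu> 0 * c:]"
  by (rule poly_eqI) (auto simp: coeff_diag_op coeff_pCons split: nat.split)

lemma diag_op_diag_op: "diag_op n \<mu> (diag_op n \<nu> f) = diag_op n (\<lambda>k. \<mu> k * \<nu> k) f"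
  by (rule poly_eqI) (simp add: coeff_diag_op)

lemma poly_0_diag_op: "poly (diag_op n \<nu> f) 0 = \<nu> 0 * poly f 0"
  by (simp add: poly_0_coeff_0 coeff_diag_op)

lemma conj_reverse_diag_op:
  "conj_reverse n (diag_op n \<nu> f) = diag_op n (\<lambda>k. cnj (\<nu> (n - k))) (conj_reverse n f)"
  by (rule poly_eqI) (simp add: coeff_diag_op coeff_conj_reverse)

lemma cmod_conj_reverse_circle:
  assumes "degree f \<le> n" "cmod z = 1"
  shows "cmod (poly (conj_reverse n f) z) = cmod (poly f z)"
proof -
  have z: "z * cnj z = 1" using assms(2) complex_norm_square[of z] by simp
  have "poly (conj_reverse n f) z = (\<Sum>k\<le>n. cnj (coeff f (n - k)) * z ^ k)"
    by (simp add: conj_reverse_def poly_sum poly_monom)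
  also have "\<dots> = (\<Sum>k\<le>n. cnj (coeff f k) * z ^ (n - k))"
    by (rule sum.reindex_bij_witness[of _ "\<lambda>k. n - k" "\<lambda>k. n - k"]) auto
  also have "\<dots> = (\<Sum>k\<le>n. z ^ n * cnj (coeff f k * z ^ k))"
  proof (rule sum.cong[OF refl])
    fix k assume "k \<in> {..n}"
    then have "z ^ n = z ^ (n - k) * z ^ k" by (simp flip: power_add)
    then have "z ^ n * cnj (z ^ k) = z ^ (n - k) * (z * cnj z) ^ k"
      by (simp add: power_mult_distrib)
    then show "cnj (coeff f k) * z ^ (n - k) = z ^ n * cnj (coeff f k * z ^ k)"
      using z by (simp add: mult.left_commute)
  qed
  also have "\<dots> = z ^ n * cnj (poly f z)"
    by (subst (2) poly_as_sum_of_monoms'[OF assms(1), symmetric])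
      (simp add: poly_sum poly_monom sum_distrib_left)
  finally show ?thesis using assms(2) by (simp add: norm_mult norm_power)
qed

lemma conj_reverse_linear_factor:
  assumes "degree g \<le> n"
  shows "conj_reverse (Suc n) ([:- r, 1:] * g) = [:1, - cnj r:] * conj_reverse n g"
proof (rule poly_eqI)
  fix k
  have top: "coeff g (Suc n) = 0" using assms by (simp add: coeff_eq_0)
  show "coeff (conj_reverse (Suc n) ([:- r, 1:] * g)) k = coeff ([:1, - cnj r:] * conj_reverse n g) k"
  proof (cases k)
    case 0
    then show ?thesis using top by (simp add: coeff_conj_reverse)
  next
    case (Suc j)
    then consider "j < n" | "j = n" | "j > n" by linarith
    then show ?thesis
    proof cases
      case 1
      then obtain m where m: "n = j + Suc m" by (metis less_iff_Suc_add add_Suc_right)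
      show ?thesis unfolding Suc m by (simp add: coeff_conj_reverse)
    qed (use Suc in \<open>auto simp: coeff_conj_reverse\<close>)
  qed
qed

text \<open>
  Up to a unimodular constant, \<open>conj_reverse n f / f\<close> is a product of powers of \<open>z\<close> and of factors
  \<open>(1 - cnj r * z) / (z - r)\<close> with \<open>1 \<le> cmod r\<close>, each bounded by \<open>1\<close> on the disc.
\<close>

lemma conj_reverse_le:
  assumes "zero_free n f" "cmod z \<le> 1"
  shows "cmod (poly (conj_reverse n f) z) \<le> cmod (poly f z)"
  using assms(1)
proof (induction rule: zero_free_induct)
  case (const n c)
  have "conj_reverse n [:c:] = monom (cnj c) n"
    by (rule poly_eqI) (auto simp: coeff_conj_reverse coeff_pCons split: nat.split)
  then show ?case
    using assms(2) by (simp add: poly_monom norm_mult norm_power mult_left_le power_le_one)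
next
  case (factor n r g)
  have "cmod (1 - cnj r * z) * cmod (poly (conj_reverse n g) z) \<le> cmod (z - r) * cmod (poly g z)"
    using factor assms(2) by (intro mult_mono disc_factor_le) auto
  then show ?case
    unfolding conj_reverse_linear_factor[OF zero_freeD(1)[OF factor(2)]] poly_linear_factor_mult
    by (simp add: norm_mult[symmetric] algebra_simps)
qed

section \<open>Laguerre's theorem on polar derivatives\<close>

text \<open>
  This is the inequality \<open>cmod (pderiv f) \<le> cmod (n f - z pderiv f)\<close> of the next lemma, squared and
  with the square completed. In this form a product of linear factors is no harder than one factor:
  the expression inside the modulus, divided by \<open>f\<close>, is additive over the factors, each
  contributes \<open>(1 - cnj z * r) / (z - r)\<close>, a missing root contributes \<open>cnj z\<close>, and these have modulus at most \<open>1\<close>.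
\<close>

lemma zero_free_schwarz_pick:
  assumes "zero_free n f" "cmod z < 1"
  shows "cmod ((1 - (cmod z)\<^sup>2) * poly (pderiv f) z + n * cnj z * poly f z) \<le> n * cmod (poly f z)"
  using assms(1)
proof (induction rule: zero_free_induct)
  case (const n c)
  have "real n * (cmod z * cmod c) \<le> real n * cmod c"
    using assms(2) by (intro mult_left_mono mult_left_le_one_le) auto
  then show ?case
    by (simp add: norm_mult)
next
  case (factor n r g)
  let ?w = "1 - of_real ((cmod z)\<^sup>2) :: complex"
  have zz: "of_real ((cmod z)\<^sup>2) = z * cnj z"
    by (rule complex_norm_square)
  have "?w * poly (pderiv ([:- r, 1:] * g)) z + Suc n * cnj z * poly ([:- r, 1:] * g) z
      = (z - r) * (?w * poly (pderiv g) z + n * cnj z * poly g z) + poly g z * (1 - cnj z * r)"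
    unfolding zz poly_linear_factor_mult poly_pderiv_linear_factor_mult by (simp add: algebra_simps)
  also have "cmod \<dots> \<le> cmod (z - r) * (n * cmod (poly g z)) + cmod (poly g z) * cmod (z - r)"
  proof (rule norm_triangle_le[OF add_mono])
    show "cmod ((z - r) * (?w * poly (pderiv g) z + n * cnj z * poly g z))
        \<le> cmod (z - r) * (n * cmod (poly g z))"
      using factor(3) by (simp add: norm_mult mult_left_mono)
    have "cmod (1 - cnj z * r) = cmod (1 - cnj r * z)"
      using complex_mod_cnj[of "1 - cnj z * r"] by (simp add: mult.commute)
    then have "cmod (1 - cnj z * r) \<le> cmod (z - r)"
      using disc_factor_le[of z r] factor(1) assms(2) by simp
    then show "cmod (poly g z * (1 - cnj z * r)) \<le> cmod (poly g z) * cmod (z - r)"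
      by (simp add: norm_mult mult_left_mono)
  qed
  also have "\<dots> = Suc n * cmod (poly ([:- r, 1:] * g) z)"
    unfolding poly_linear_factor_mult norm_mult by (simp add: algebra_simps)
  finally show ?case by simp
qed

lemma zero_free_deriv_le:
  assumes "zero_free n f" "cmod z < 1"
  shows "cmod (poly (pderiv f) z) \<le> cmod (n * poly f z - z * poly (pderiv f) z)"
proof -
  define d where "d = poly (pderiv f) z"
  define v where "v = of_nat n * poly f z"
  define s where "s = 1 - (cmod z)\<^sup>2"
  have s: "s > 0" using assms(2) by (simp add: s_def abs_square_less_1)
  have "cmod (s * d + cnj z * v) \<le> cmod v"
    using zero_free_schwarz_pick[OF assms] by (simp add: d_def v_def s_def norm_mult algebra_simps)
  then have "(cmod (s * d + cnj z * v))\<^sup>2 \<le> (cmod v)\<^sup>2"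
    by (simp add: power_mono)
  moreover have "(cmod (s * d + cnj z * v))\<^sup>2 - (cmod v)\<^sup>2
      = s * ((cmod d)\<^sup>2 - (cmod (v - z * d))\<^sup>2)"
    unfolding s_def cmod_power2 by (simp add: power2_eq_square algebra_simps)
  ultimately have "s * ((cmod d)\<^sup>2 - (cmod (v - z * d))\<^sup>2) \<le> 0" by linarith
  then have "(cmod d)\<^sup>2 \<le> (cmod (v - z * d))\<^sup>2"
    using s by (simp add: mult_le_0_iff)
  then show ?thesis unfolding d_def v_def by (rule power2_le_imp_le) simp
qed

text \<open>
  For \<open>a = 1\<close> this is the polar derivative with pole \<open>b\<close>. The homogeneous parameters also cover
  the ordinary derivative, the pole at infinity, as \<open>a = 0\<close>.
\<close>

definition polar_deriv :: "nat \<Rightarrow> complex \<Rightarrow> complex \<Rightarrow> complex poly \<Rightarrow> complex poly" where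
  "polar_deriv n a b f = smult (a * of_nat n) f + [:b, - a:] * pderiv f"

text \<open>
  Laguerre's theorem with the pole \<open>b / a\<close> in the open disc. At a point of the disc the polar derivative is
  \<open>a * (Suc n * f - z * pderiv f) + b * pderiv f\<close>, and its first summand dominates strictly.
\<close>

lemma laguerre_polar_deriv:
  assumes "zero_free (Suc n) f" "cmod b < cmod a"
  shows "zero_free n (polar_deriv (Suc n) a b f)"
  unfolding zero_free_def
proof (intro conjI allI impI)
  have "coeff (polar_deriv (Suc n) a b f) k = 0" if "k > n" for k
  proof -
    from that obtain j where j: "k = Suc j" by (cases k) auto
    have "coeff f (Suc k) = 0" using that zero_freeD(1)[OF assms(1)] by (simp add: coeff_eq_0)
    moreover have "coeff f k = 0 \<or> k = Suc n"
      using that zero_freeD(1)[OF assms(1)] by (auto simp: coeff_eq_0)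
    ultimately show ?thesis unfolding j
      by (auto simp: polar_deriv_def coeff_pderiv algebra_simps)
  qed
  then show "degree (polar_deriv (Suc n) a b f) \<le> n" by (intro degree_le) auto
next
  fix z :: complex assume z: "cmod z < 1"
  define d where "d = poly (pderiv f) z"
  define w where "w = of_nat (Suc n) * poly f z - z * d"
  have eq: "poly (polar_deriv (Suc n) a b f) z = a * w + b * d"
    by (simp add: polar_deriv_def w_def d_def algebra_simps)
  have le: "cmod d \<le> cmod w"
    using zero_free_deriv_le[OF assms(1) z] by (simp add: d_def w_def)
  have "w \<noteq> 0"
  proof
    assume w: "w = 0"
    with le have "d = 0" by simp
    with w have "of_nat (Suc n) * poly f z = 0" unfolding w_def by simp
    then have "poly f z = 0"
      using of_nat_neq_0 by (metis mult_eq_0_iff)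
    then show False using zero_freeD(2)[OF assms(1) z] by blast
  qed
  then have "cmod b * cmod w < cmod a * cmod w"
    using assms(2) by simp
  moreover have "cmod b * cmod d \<le> cmod b * cmod w"
    using le by (intro mult_left_mono) auto
  ultimately have "cmod (b * d) < cmod (a * w)"
    unfolding norm_mult by linarith
  then show "poly (polar_deriv (Suc n) a b f) z \<noteq> 0"
    unfolding eq by (metis add_eq_0_iff norm_minus_cancel order_less_irrefl)
qed

section \<open>Multipliers that keep the open disc free of zeros\<close>

text \<open>The multipliers of the diagonal operator conjugated by \<open>conj_reverse n\<close>.\<close>

definition dual_mult :: "nat \<Rightarrow> (nat \<Rightarrow> complex) \<Rightarrow> nat \<Rightarrow> complex" where
  "dual_mult n \<nu> k = cnj (\<nu> (n - k))"

definition preserves_zero_free :: "nat \<Rightarrow> (nat \<Rightarrow> complex) \<Rightarrow> bool" where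
  "preserves_zero_free n \<kappa> \<longleftrightarrow> (\<forall>f. zero_free n f \<longrightarrow> zero_free n (diag_op n \<kappa> f))"

lemma preserves_zero_freeD: "preserves_zero_free n \<kappa> \<Longrightarrow> zero_free n f \<Longrightarrow> zero_free n (diag_op n \<kappa> f)"
  by (simp add: preserves_zero_free_def)

lemma preserves_zero_free_mult:
  assumes "preserves_zero_free n \<kappa>" "preserves_zero_free n \<mu>"
  shows "preserves_zero_free n (\<lambda>k. \<kappa> k * \<mu> k)"
  using assms by (simp add: preserves_zero_free_def flip: diag_op_diag_op)

lemma diag_op_diff: "diag_op n (\<lambda>k. \<kappa> k - \<mu> k) f = diag_op n \<kappa> f - diag_op n \<mu> f"
  by (rule poly_eqI) (simp add: coeff_diag_op algebra_simps)

lemma diag_op_scalar: "degree f \<le> n \<Longrightarrow> diag_op n (\<lambda>k. c) f = smult c f"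
  by (rule poly_eqI) (auto simp add: coeff_diag_op coeff_eq_0)

lemma poly_diag_op_power:
  "poly (diag_op n (\<lambda>k. c ^ k * \<nu> k) f) z = poly (diag_op n \<nu> f) (c * z)"
  unfolding poly_diag_op by (intro sum.cong) (auto simp: power_mult_distrib)

text \<open>
  Dilating by \<open>R > 1\<close> moves every root, which lies outside the open disc, away from the points of
  the disc: \<open>cmod (z - r) < cmod (z - R * r)\<close>; every missing root contributes a factor \<open>R\<close>.
\<close>

lemma zero_free_dilation_growth:
  fixes R :: real
  assumes "zero_free n f" "R > 1" "cmod z < 1"
  shows "cmod (poly f z) \<le> R ^ n * cmod (poly f (z / R))
    \<and> (n > 0 \<longrightarrow> cmod (poly f z) < R ^ n * cmod (poly f (z / R)))"
  using assms(1)
proof (induction rule: zero_free_induct)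
  case (const n c)
  then show ?case using assms(2) by simp
next
  case (factor n r g)
  have "R * Re (z * cnj r) < R * (cmod r)\<^sup>2"
  proof -
    have "Re (z * cnj r) \<le> cmod z * cmod r"
      using complex_Re_le_cmod[of "z * cnj r"] by (simp add: norm_mult)
    also have "\<dots> < cmod r * cmod r"
      using assms(3) factor(1) by (intro mult_strict_right_mono) auto
    finally show ?thesis using assms(2) by (simp add: power2_eq_square)
  qed
  moreover have "(cmod (z - R * r))\<^sup>2 - (cmod (z - r))\<^sup>2
      = (R - 1) * ((R + 1) * (cmod r)\<^sup>2 - 2 * Re (z * cnj r))"
    unfolding cmod_power2 by (simp add: power2_eq_square algebra_simps)
  moreover have "Re (z * cnj r) < (cmod r)\<^sup>2"
    using calculation(1) assms(2) by simp
  moreover have "2 * (cmod r)\<^sup>2 \<le> (R + 1) * (cmod r)\<^sup>2"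
    using assms(2) by (intro mult_right_mono) auto
  ultimately have "0 < (cmod (z - R * r))\<^sup>2 - (cmod (z - r))\<^sup>2"
    using assms(2) by (simp add: zero_less_mult_iff)
  then have "(cmod (z - r))\<^sup>2 < (cmod (z - R * r))\<^sup>2" by simp
  then have "cmod (z - r) < cmod (z - R * r)"
    by (rule power2_less_imp_less) simp
  moreover have "z - R * r = R * (z / R - r)"
    using assms(2) by (simp add: field_simps)
  ultimately have lt: "cmod (z - r) < R * cmod (z / R - r)"
    using assms(2) by (simp add: norm_mult)
  have pos: "0 < cmod (poly g z)"
    using zero_freeD(2)[OF factor(2) assms(3)] by simp
  have "cmod (z - r) * cmod (poly g z) < (R * cmod (z / R - r)) * (R ^ n * cmod (poly g (z / R)))"
    using lt pos factor(3) by (intro mult_less_le_imp_less) auto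
  then show ?case
    unfolding poly_linear_factor_mult norm_mult by (simp add: mult_ac)
qed

lemma preserves_zero_free_dilation_diff:
  fixes R :: real and \<alpha> :: complex
  assumes "n \<ge> 1" "R > 1" "cmod \<alpha> \<le> 1"
  shows "preserves_zero_free n (dual_mult n (\<lambda>k. R ^ k - \<alpha>))"
  unfolding preserves_zero_free_def zero_free_def
proof (intro allI impI conjI degree_diag_op)
  fix f z assume f: "degree f \<le> n \<and> (\<forall>z. cmod z < 1 \<longrightarrow> poly f z \<noteq> 0)" and z: "cmod z < 1"
  then have zf: "zero_free n f" by (simp add: zero_free_def)
  have "dual_mult n (\<lambda>k. R ^ k - \<alpha>) = (\<lambda>k. of_real R ^ (n - k) - cnj \<alpha>)"
    by (simp add: dual_mult_def fun_eq_iff)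
  then have "poly (diag_op n (dual_mult n (\<lambda>k. R ^ k - \<alpha>)) f) z
      = (\<Sum>k\<le>n. of_real R ^ (n - k) * coeff f k * z ^ k) - cnj \<alpha> * poly f z"
    using f by (simp add: diag_op_diff diag_op_scalar poly_diag_op)
  also have "(\<Sum>k\<le>n. of_real R ^ (n - k) * coeff f k * z ^ k) = R ^ n * poly f (z / R)"
    using f assms(2)
    by (subst (2) poly_as_sum_of_monoms'[of f n, symmetric])
      (auto simp add: poly_sum poly_monom sum_distrib_left power_diff power_divide intro!: sum.cong)
  finally have eq: "poly (diag_op n (dual_mult n (\<lambda>k. R ^ k - \<alpha>)) f) z
      = R ^ n * poly f (z / R) - cnj \<alpha> * poly f z" .
  have "cmod (cnj \<alpha> * poly f z) \<le> cmod (poly f z)"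
    using assms(3) by (simp add: norm_mult mult_left_le_one_le)
  also have "\<dots> < R ^ n * cmod (poly f (z / R))"
    using zero_free_dilation_growth[OF zf assms(2) z] assms(1) by simp
  also have "\<dots> = cmod (R ^ n * poly f (z / R))"
    using assms(2) by (simp add: norm_mult norm_power)
  finally show "poly (diag_op n (dual_mult n (\<lambda>k. R ^ k - \<alpha>)) f) z \<noteq> 0"
    unfolding eq by auto
qed

lemma quadratic_factorization:
  fixes X Y Z :: complex
  assumes "Z \<noteq> 0"
  obtains w1 w2 where "X = Z * w1 * w2" "Y = - Z * (w1 + w2)"
proof -
  define d where "d = csqrt (Y\<^sup>2 - 4 * X * Z)"
  have d: "d\<^sup>2 = Y\<^sup>2 - 4 * X * Z" by (simp add: d_def)
  show ?thesis
  proof (rule that[of "(- Y + d) / (2 * Z)" "(- Y - d) / (2 * Z)"])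
    have "Z * ((- Y + d) / (2 * Z)) * ((- Y - d) / (2 * Z)) = (Y\<^sup>2 - d\<^sup>2) / (4 * Z)"
      using assms by (simp add: field_simps power2_eq_square)
    then show "X = Z * ((- Y + d) / (2 * Z)) * ((- Y - d) / (2 * Z))"
      using assms unfolding d by simp
    show "Y = - Z * ((- Y + d) / (2 * Z) + (- Y - d) / (2 * Z))"
      using assms by (simp add: field_simps)
  qed
qed

text \<open>
  A homogeneous form of the root condition of \<open>admissible_B\<close>, rescaled so that the half plane is
  \<open>cmod w \<le> cmod (w - 1)\<close>: the quadratic is \<open>(b1 + s1 * w) * (b2 + s2 * w)\<close>, and a root at
  infinity, that is a drop of the degree, is a factor with \<open>s = 0\<close>. The zero polynomial is excluded by the
  hypothesis, because \<open>1\<close> lies outside the half plane.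
\<close>

lemma half_plane_factorization:
  fixes X Y Z :: complex
  assumes roots: "\<And>w. X + Y * w + Z * w\<^sup>2 = 0 \<Longrightarrow> cmod w \<le> cmod (w - 1)"
  obtains b1 s1 b2 s2 where "X = b1 * b2" "Y = s1 * b2 + s2 * b1" "Z = s1 * s2"
    "cmod b1 \<le> cmod (b1 + s1)" "b1 + s1 \<noteq> 0" "cmod b2 \<le> cmod (b2 + s2)" "b2 + s2 \<noteq> 0"
proof -
  have ne1: "w \<noteq> 1" if "X + Y * w + Z * w\<^sup>2 = 0" for w
    using roots[OF that] by auto
  consider "Z \<noteq> 0" | "Z = 0" "Y \<noteq> 0" | "Z = 0" "Y = 0" by blast
  then show ?thesis
  proof cases
    case 1
    obtain w1 w2 where w: "X = Z * w1 * w2" "Y = - Z * (w1 + w2)"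
      using quadratic_factorization[OF 1, of X Y] by blast
    have r1: "X + Y * w1 + Z * w1\<^sup>2 = 0" and r2: "X + Y * w2 + Z * w2\<^sup>2 = 0"
      unfolding w by (simp_all add: algebra_simps power2_eq_square)
    show ?thesis
    proof (rule that[of "- Z * w1" "- w2" Z 1])
      have "- Z * w1 + Z = - Z * (w1 - 1)" by (simp add: algebra_simps)
      then show "cmod (- Z * w1) \<le> cmod (- Z * w1 + Z)" "- Z * w1 + Z \<noteq> 0"
        using roots[OF r1] ne1[OF r1] 1 by (simp_all add: norm_mult mult_left_mono)
      have "- w2 + 1 = - (w2 - 1)" by simp
      then show "cmod (- w2) \<le> cmod (- w2 + 1)" "- w2 + 1 \<noteq> 0"
        using roots[OF r2] ne1[OF r2] by (simp_all only: norm_minus_cancel) auto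
    qed (use w in \<open>auto simp: algebra_simps\<close>)
  next
    case 2
    have r: "X + Y * (- X / Y) + Z * (- X / Y)\<^sup>2 = 0" using 2 by simp
    have "X + Y = - Y * (- X / Y - 1)" "X = - Y * (- X / Y)" using 2 by (auto simp: field_simps)
    then have "cmod (X + Y) = cmod Y * cmod (- X / Y - 1)" "cmod X = cmod Y * cmod (- X / Y)"
      by (metis norm_mult norm_minus_cancel)+
    moreover have "X + Y \<noteq> 0"
      using ne1[OF r] 2 by (auto simp: add_eq_0_iff)
    ultimately have "cmod X \<le> cmod (X + Y)" "X + Y \<noteq> 0"
      using roots[OF r] by (auto simp only: mult_left_mono norm_ge_zero)
    then show ?thesis using 2 by (intro that[of X 1 Y 0]) auto
  next
    case 3
    then have "X \<noteq> 0" using roots[of 1] by auto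
    then show ?thesis using 3 by (intro that[of X 1 0 0]) auto
  qed
qed

section \<open>The multipliers of the operators B\<close>

definition mult_B :: "nat \<Rightarrow> complex \<Rightarrow> complex \<Rightarrow> complex \<Rightarrow> nat \<Rightarrow> complex" where
  "mult_B n l0 l1 l2 k = l0 + l1 * (of_nat n / 2) * of_nat k
     + l2 * (of_nat n ^ 2 / 8) * (of_nat k * (of_nat k - 1))"

lemma poly_diag_op_quadratic:
  assumes "degree f \<le> n" and \<kappa>: "\<And>k. k \<le> n \<Longrightarrow> \<kappa> k = e0 + e1 * of_nat k + e2 * (of_nat k * (of_nat k - 1))"
  shows "poly (diag_op n \<kappa> f) z
    = e0 * poly f z + e1 * z * poly (pderiv f) z + e2 * z\<^sup>2 * poly (pderiv (pderiv f)) z"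
proof -
  have "diag_op n \<kappa> f = smult e0 f + smult e1 (pCons 0 (pderiv f))
      + smult e2 (pCons 0 (pCons 0 (pderiv (pderiv f))))"
  proof (rule poly_eqI)
    fix k
    show "coeff (diag_op n \<kappa> f) k = coeff (smult e0 f + smult e1 (pCons 0 (pderiv f))
      + smult e2 (pCons 0 (pCons 0 (pderiv (pderiv f))))) k"
    proof (cases "k \<le> n")
      case True
      then show ?thesis
        by (auto simp: coeff_diag_op \<kappa> coeff_pCons coeff_pderiv algebra_simps split: nat.split)
    next
      case False
      then have "coeff f k = 0" using assms(1) by (simp add: coeff_eq_0)
      then show ?thesis using False
        by (auto simp: coeff_diag_op coeff_pCons coeff_pderiv split: nat.split)
    qed
  qed
  then show ?thesis by (simp add: power2_eq_square algebra_simps)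
qed

text \<open>
  When the poles are proportional to the point of evaluation, two polar derivatives produce an
  Euler operator in \<open>f\<close>, \<open>z * pderiv f\<close> and \<open>z\<^sup>2 * pderiv (pderiv f)\<close>, which is the shape of the dual of
  \<open>B\<close>. The bound \<open>cmod b \<le> cmod (b + s)\<close> of the factorization above says that, for \<open>cmod z < 1\<close>, these
  poles lie in the open disc.
\<close>

lemma poly_polar_deriv_polar_deriv:
  "poly (polar_deriv m a2 ((a2 - s2) * z) (polar_deriv (Suc m) a1 ((a1 - s1) * z) f)) z
    = of_nat (Suc m) * of_nat m * (a1 * a2) * poly f z
      - of_nat m * (a2 * s1 + a1 * s2) * z * poly (pderiv f) z
      + s1 * s2 * z\<^sup>2 * poly (pderiv (pderiv f)) z"
proof -
  have "pderiv (polar_deriv (Suc m) a1 b f)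
      = smult (a1 * of_nat m) (pderiv f) + [:b, - a1:] * pderiv (pderiv f)" for b
    by (rule poly_eqI) (simp add: polar_deriv_def coeff_pderiv coeff_pCons algebra_simps split: nat.split)
  then show ?thesis
    by (simp only: polar_deriv_def[of m] poly_add poly_smult poly_mult)
       (simp add: polar_deriv_def power2_eq_square algebra_simps)
qed

text \<open>
  At each point of the disc the dual of \<open>B\<close> coincides with two successive polar derivatives whose poles are in the
  open disc, one for each root of the quadratic that defines admissibility; for \<open>n = 1\<close> a single polar
  derivative is left. Laguerre's theorem shows that the value is not zero.
\<close>

lemma preserves_zero_free_mult_B:
  assumes "n \<ge> 1" "admissible_B n l0 l1 l2"
  shows "preserves_zero_free n (dual_mult n (mult_B n l0 l1 l2))"
  unfolding preserves_zero_free_def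
proof (intro allI impI)
  fix f assume zf: "zero_free n f"
  have shrink: "cmod (b * z) < cmod a" if "cmod b \<le> cmod a" "a \<noteq> 0" "cmod z < 1" for a b z :: complex
  proof (cases "b = 0")
    case False
    then have "cmod (b * z) < cmod b" using that by (simp add: norm_mult)
    with that show ?thesis by linarith
  qed (use that in auto)
  note deg = zero_freeD(1)[OF zf]
  have adm: "cmod w \<le> cmod (w - of_nat n / 2)"
    if "l0 + l1 * of_nat n * w + l2 * of_nat (n choose 2) * w\<^sup>2 = 0" for w
    using assms(2) that by (auto simp: admissible_B_def char_poly_B_def power2_eq_square algebra_simps)
  show "zero_free n (diag_op n (dual_mult n (mult_B n l0 l1 l2)) f)"
    unfolding zero_free_def
  proof (intro conjI allI impI degree_diag_op)
    fix z :: complex assume z: "cmod z < 1"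
    show "poly (diag_op n (dual_mult n (mult_B n l0 l1 l2)) f) z \<noteq> 0"
    proof (cases "n = 1")
      case True
      have "l0 + l1 / 2 \<noteq> 0 \<and> cmod l0 \<le> cmod (l0 + l1 / 2)"
      proof (cases "l1 = 0")
        case True
        then show ?thesis using adm[of "1 / 2"] \<open>n = 1\<close> by auto
      next
        case False
        have "- l0 / l1 - 1 / 2 = - (l0 + l1 / 2) / l1" using False by (simp add: field_simps)
        moreover have "cmod (- l0 / l1) \<le> cmod (- l0 / l1 - 1 / 2)"
          using adm[of "- l0 / l1"] False \<open>n = 1\<close> by simp
        ultimately have "cmod l0 \<le> cmod (l0 + l1 / 2)"
          using False by (simp add: norm_divide divide_le_cancel norm_minus_commute del: minus_add_distrib)
        then show ?thesis using False by (metis add_0 divide_eq_0_iff norm_eq_zero norm_le_zero_iff zero_neq_numeral)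
      qed
      then have *: "cnj (l0 + l1 / 2) \<noteq> 0" "cmod (cnj l0) \<le> cmod (cnj (l0 + l1 / 2))"
        by (auto simp only: complex_mod_cnj complex_cnj_zero_iff)
      have "cmod (cnj l0 * z) < cmod (cnj (l0 + l1 / 2))"
        by (rule shrink[OF *(2,1) z])
      from laguerre_polar_deriv[OF zf[unfolded True One_nat_def] this]
      have "poly (polar_deriv 1 (cnj (l0 + l1 / 2)) (cnj l0 * z) f) z \<noteq> 0"
        using zero_freeD(2) z by simp
      moreover have "poly (diag_op n (dual_mult n (mult_B n l0 l1 l2)) f) z
          = cnj (l0 + l1 / 2) * poly f z + (- cnj l1 / 2) * z * poly (pderiv f) z
            + 0 * z\<^sup>2 * poly (pderiv (pderiv f)) z"
      proof (rule poly_diag_op_quadratic[OF deg])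
        fix k assume "k \<le> n"
        then have "k = 0 \<or> k = 1" using True by auto
        then show "dual_mult n (mult_B n l0 l1 l2) k = cnj (l0 + l1 / 2) + - cnj l1 / 2 * of_nat k
            + 0 * (of_nat k * (of_nat k - 1))"
          using True by (auto simp: dual_mult_def mult_B_def)
      qed
      moreover have "poly (polar_deriv 1 (cnj (l0 + l1 / 2)) (cnj l0 * z) f) z
          = cnj (l0 + l1 / 2) * poly f z + (- cnj l1 / 2) * z * poly (pderiv f) z"
        by (simp add: polar_deriv_def algebra_simps)
      ultimately show ?thesis by simp
    next
      case False
      then obtain m where m: "n = Suc (Suc m)"
        using assms(1) by (metis One_nat_def Suc_le_D not0_implies_Suc)
      define N where "N = (of_nat n :: complex)"
      have N: "N = of_nat m + 2" "N \<noteq> 0" "N - 1 \<noteq> 0"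
        unfolding N_def m using of_nat_neq_0[of "Suc m", where 'a = complex] of_nat_neq_0[of m, where 'a = complex]
        by (simp_all add: add_ac)
      have "2 * (n choose 2) = n * (n - 1)" by (simp add: choose_two m)
      then have "of_nat (2 * (n choose 2)) = (of_nat (n * (n - 1)) :: complex)" by (rule arg_cong)
      then have ch: "of_nat (n choose 2) = N * (N - 1) / 2"
        using m by (simp add: N_def of_nat_diff algebra_simps)
      \<comment> \<open>The factor \<open>N * (N - 1)\<close> is what two polar derivatives produce in front of \<open>f\<close>; the
        substitution \<open>w \<mapsto> N * w / 2\<close> below normalises the half plane.\<close>
      define X Y Z where "X = l0 / (N * (N - 1))" and "Y = l1 * N / (2 * (N - 1))"
        and "Z = l2 * N\<^sup>2 / 8"
      have X: "l0 = N * (N - 1) * X" using N(2,3) by (simp add: X_def)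
      have Y: "l1 * (N / 2) = (N - 1) * Y" using N(3) by (simp add: Y_def field_simps)
      have Z: "l2 * (N ^ 2 / 8) = Z" by (simp add: Z_def)
      have roots: "cmod w \<le> cmod (w - 1)" if "X + Y * w + Z * w\<^sup>2 = 0" for w
      proof -
        have "l0 + l1 * of_nat n * (N * w / 2) + l2 * of_nat (n choose 2) * (N * w / 2)\<^sup>2
            = l0 + l1 * (N / 2) * (N * w) + l2 * (N ^ 2 / 8) * (N * (N - 1) * w\<^sup>2)"
          unfolding ch unfolding N_def[symmetric]
          by (simp add: field_simps power2_eq_square)
        also have "\<dots> = N * (N - 1) * (X + Y * w + Z * w\<^sup>2)"
          unfolding Y Z by (subst X) (simp add: algebra_simps)
        finally have "l0 + l1 * of_nat n * (N * w / 2) + l2 * of_nat (n choose 2) * (N * w / 2)\<^sup>2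
            = N * (N - 1) * (X + Y * w + Z * w\<^sup>2)" .
        then have "cmod (N * w / 2) \<le> cmod (N * w / 2 - of_nat n / 2)"
          using that by (intro adm) simp
        also have "N * w / 2 - of_nat n / 2 = N * (w - 1) / 2"
          by (simp add: N_def algebra_simps diff_divide_distrib)
        finally show ?thesis using N(2) by (simp add: norm_mult norm_divide)
      qed
      obtain b1 s1 b2 s2 where fact: "X = b1 * b2" "Y = s1 * b2 + s2 * b1" "Z = s1 * s2"
        and le: "cmod b1 \<le> cmod (b1 + s1)" "b1 + s1 \<noteq> 0" "cmod b2 \<le> cmod (b2 + s2)" "b2 + s2 \<noteq> 0"
        using half_plane_factorization[of X Y Z] roots by metis
      define a1 a2 where "a1 = cnj (b1 + s1)" and "a2 = cnj (b2 + s2)"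
      have small: "cmod ((a1 - cnj s1) * z) < cmod a1" "cmod ((a2 - cnj s2) * z) < cmod a2"
      proof -
        have "a1 - cnj s1 = cnj b1" "a2 - cnj s2 = cnj b2" by (simp_all add: a1_def a2_def)
        moreover have "cmod (cnj b1 * z) < cmod a1" "cmod (cnj b2 * z) < cmod a2"
          using le z unfolding a1_def a2_def
          by (auto simp only: complex_mod_cnj complex_cnj_zero_iff intro!: shrink)
        ultimately show "cmod ((a1 - cnj s1) * z) < cmod a1" "cmod ((a2 - cnj s2) * z) < cmod a2"
          by simp_all
      qed
      let ?g = "polar_deriv (Suc m) a2 ((a2 - cnj s2) * z)
        (polar_deriv (Suc (Suc m)) a1 ((a1 - cnj s1) * z) f)"
      have "zero_free m ?g"
        using zf small unfolding m by (intro laguerre_polar_deriv)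
      then have "poly ?g z \<noteq> 0" using zero_freeD(2) z by blast
      moreover have "poly (diag_op n (dual_mult n (mult_B n l0 l1 l2)) f) z
          = N * (N - 1) * (a1 * a2) * poly f z
            + (- (N - 1) * (a2 * cnj s1 + a1 * cnj s2)) * z * poly (pderiv f) z
            + (cnj s1 * cnj s2) * z\<^sup>2 * poly (pderiv (pderiv f)) z"
      proof (rule poly_diag_op_quadratic[OF deg])
        fix k assume k: "k \<le> n"
        have mB: "mult_B n l0 l1 l2 (n - k) = N * (N - 1) * (b1 * b2) + (N - 1) * (s1 * b2 + s2 * b1) * (N - of_nat k)
            + s1 * s2 * ((N - of_nat k) * (N - of_nat k - 1))"
          unfolding mult_B_def N_def[symmetric] Y Z fact[symmetric]
          by (subst X) (use k in \<open>simp add: of_nat_diff N_def\<close>)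
        have "cnj N = N" by (simp add: N_def)
        then show "dual_mult n (mult_B n l0 l1 l2) k = N * (N - 1) * (a1 * a2)
            + (- (N - 1) * (a2 * cnj s1 + a1 * cnj s2)) * of_nat k
            + (cnj s1 * cnj s2) * (of_nat k * (of_nat k - 1))"
          unfolding dual_mult_def mB a1_def a2_def by (simp add: algebra_simps)
      qed
      moreover have "poly ?g z = N * (N - 1) * (a1 * a2) * poly f z
            + (- (N - 1) * (a2 * cnj s1 + a1 * cnj s2)) * z * poly (pderiv f) z
            + (cnj s1 * cnj s2) * z\<^sup>2 * poly (pderiv (pderiv f)) z"
        unfolding poly_polar_deriv_polar_deriv N(1) by (simp add: algebra_simps)
      ultimately show ?thesis by simp
    qed
  qed
qed

section \<open>Comparison of an operator with its dual\<close>

lemma le_cball_of_le_ball: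
  fixes f :: "complex \<Rightarrow> real"
  assumes "continuous_on UNIV f" "\<And>w. cmod w < 1 \<Longrightarrow> f w \<le> a" "cmod z \<le> 1"
  shows "f z \<le> a"
proof (rule continuous_le_on_closure[of "ball 0 1" f z a])
  show "continuous_on (closure (ball 0 1)) f" using assms(1) by (rule continuous_on_subset) simp
qed (use assms in \<open>auto simp: dist_norm\<close>)

lemma zero_free_dilation:
  assumes "zero_free n f" "0 \<le> r" "r \<le> 1"
  shows "zero_free n (diag_op n (\<lambda>k. of_real r ^ k) f)"
  unfolding zero_free_def
proof (intro conjI allI impI degree_diag_op)
  fix z :: complex assume z: "cmod z < 1"
  have "poly (diag_op n (\<lambda>k. of_real r ^ k) f) z = poly f (of_real r * z)"
    using poly_diag_op_power[of n "of_real r" "\<lambda>k. 1" f z] zero_freeD(1)[OF assms(1)]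
    by (simp add: diag_op_scalar)
  moreover have "cmod (of_real r * z) < 1"
    using z assms(2,3) mult_left_le_one_le[of "cmod z" r] by (simp add: norm_mult)
  ultimately show "poly (diag_op n (\<lambda>k. of_real r ^ k) f) z \<noteq> 0"
    using zero_freeD(2)[OF assms(1)] by simp
qed

text \<open>
  If the majorant \<open>g\<close> is free of zeros, so is \<open>g + c f\<close> for \<open>cmod c < 1\<close>, hence also its image. A
  point where the image of \<open>f\<close> exceeds that of \<open>g\<close> would give a \<open>c\<close> of this kind for which the image vanishes there.
\<close>

lemma diag_op_mono:
  assumes pres: "preserves_zero_free n \<kappa>" and zf: "zero_free n g" and deg: "degree f \<le> n"
    and le: "\<And>z. cmod z < 1 \<Longrightarrow> cmod (poly f z) \<le> cmod (poly g z)" and z: "cmod z \<le> 1"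
  shows "cmod (poly (diag_op n \<kappa> f) z) \<le> cmod (poly (diag_op n \<kappa> g) z)"
proof -
  define F where "F = diag_op n \<kappa> f"
  define G where "G = diag_op n \<kappa> g"
  have inside: "cmod (poly F w) \<le> cmod (poly G w)" if w: "cmod w < 1" for w
  proof (rule ccontr)
    assume neg: "\<not> ?thesis"
    define c where "c = - poly G w / poly F w"
    have c: "cmod c < 1" using neg by (auto simp: c_def norm_divide divide_less_eq)
    have "zero_free n (g + smult c f)"
      unfolding zero_free_def
    proof (intro conjI allI impI)
      show "degree (g + smult c f) \<le> n"
        by (intro degree_add_le degree_smult_le[THEN order_trans] deg zero_freeD(1)[OF zf])
      fix v :: complex assume v: "cmod v < 1"
      have "0 < cmod (poly g v)" using zero_freeD(2)[OF zf v] by simp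
      moreover have "cmod c * cmod (poly f v) \<le> cmod c * cmod (poly g v)"
        using le[OF v] by (intro mult_left_mono) auto
      moreover have "cmod c * cmod (poly g v) < 1 * cmod (poly g v)"
        using c calculation(1) by (intro mult_strict_right_mono)
      ultimately have "cmod (c * poly f v) < cmod (poly g v)"
        unfolding norm_mult by linarith
      then show "poly (g + smult c f) v \<noteq> 0"
        by (auto simp: add_eq_0_iff)
    qed
    from preserves_zero_freeD[OF pres this] have "zero_free n (G + smult c F)"
      by (simp add: F_def G_def diag_op_add diag_op_smult)
    then have "poly G w + c * poly F w \<noteq> 0" using zero_freeD(2)[OF _ w] by force
    moreover have "poly F w \<noteq> 0" using neg by auto
    ultimately show False by (simp add: c_def)
  qed
  have "continuous_on UNIV (\<lambda>w. cmod (poly F w) - cmod (poly G w))"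
    by (intro continuous_intros)
  from le_cball_of_le_ball[OF this _ z, of 0] inside show ?thesis
    by (simp add: F_def G_def)
qed

text \<open>
  On the circle the image of \<open>f\<close> has the modulus of its own conjugate reversal, which is the image
  of \<open>conj_reverse n f\<close> under the dual; and \<open>conj_reverse n f\<close> is dominated by \<open>f\<close> in the disc.
\<close>

lemma diag_op_le_dual_circle:
  assumes pres: "preserves_zero_free n (dual_mult n \<nu>)" and zf: "zero_free n f" and z: "cmod z = 1"
  shows "cmod (poly (diag_op n \<nu> f) z) \<le> cmod (poly (diag_op n (dual_mult n \<nu>) f) z)"
proof -
  have "cmod (poly (diag_op n \<nu> f) z) = cmod (poly (diag_op n (dual_mult n \<nu>) (conj_reverse n f)) z)"
    using cmod_conj_reverse_circle[OF degree_diag_op z, of n \<nu> f]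
    by (simp add: conj_reverse_diag_op dual_mult_def[abs_def])
  also have "\<dots> \<le> cmod (poly (diag_op n (dual_mult n \<nu>) f) z)"
    using z by (intro diag_op_mono[OF pres zf degree_conj_reverse] conj_reverse_le[OF zf]) auto
  finally show ?thesis .
qed

text \<open>
  A point of modulus \<open>r\<close> is reached from the circle by the dilation \<open>z \<mapsto> r * z\<close>, which is itself
  diagonal and commutes with both operators.
\<close>

lemma diag_op_le_dual:
  assumes pres: "preserves_zero_free n (dual_mult n \<nu>)" and zf: "zero_free n f" and z: "cmod z \<le> 1"
  shows "cmod (poly (diag_op n \<nu> f) z) \<le> cmod (poly (diag_op n (dual_mult n \<nu>) f) z)"
proof -
  define r where "r = cmod z"
  obtain u where u: "cmod u = 1" "z = of_real r * u"
  proof (cases "z = 0")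
    case True
    then show ?thesis by (intro that[of 1]) (auto simp: r_def)
  next
    case False
    then show ?thesis by (intro that[of "z / r"]) (auto simp: r_def norm_divide)
  qed
  have swap: "poly (diag_op n \<mu> (diag_op n (\<lambda>k. of_real r ^ k) f)) u = poly (diag_op n \<mu> f) z" for \<mu>
    using poly_diag_op_power[of n "of_real r" \<mu> f u] by (simp add: diag_op_diag_op mult.commute u)
  have "zero_free n (diag_op n (\<lambda>k. of_real r ^ k) f)"
    using zf z by (intro zero_free_dilation) (auto simp: r_def)
  from diag_op_le_dual_circle[OF pres this u(1)] show ?thesis
    unfolding swap .
qed

text \<open>
  The quotient of the two images is bounded by \<open>1\<close> in the open disc. By the maximum modulus principle it
  attains there the value \<open>- u\<close>, which has modulus \<open>1\<close>, only if it is constant.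
\<close>

lemma diag_op_add_dual_zero_free:
  assumes pres: "preserves_zero_free n (dual_mult n \<nu>)" and zf: "zero_free n f" and u: "cmod u = 1"
  shows "zero_free n (diag_op n (\<lambda>k. \<nu> k + u * dual_mult n \<nu> k) f)
    \<or> diag_op n (\<lambda>k. \<nu> k + u * dual_mult n \<nu> k) f = 0"
proof -
  define F where "F = diag_op n \<nu> f"
  define H where "H = diag_op n (dual_mult n \<nu>) f"
  have eq: "diag_op n (\<lambda>k. \<nu> k + u * dual_mult n \<nu> k) f = F + smult u H"
    unfolding F_def H_def by (rule poly_eqI) (simp add: coeff_diag_op algebra_simps)
  have H0: "poly H w \<noteq> 0" if "cmod w < 1" for w
    using zero_freeD(2)[OF preserves_zero_freeD[OF pres zf] that] by (simp add: H_def)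
  have "F + smult u H = 0" if z: "cmod z < 1" "poly (F + smult u H) z = 0" for z
  proof -
    define q where "q w = poly F w / poly H w" for w
    have qz: "q z = - u" using z H0[OF z(1)] by (simp add: q_def field_simps add_eq_0_iff)
    have "q constant_on ball 0 1"
    proof (rule maximum_modulus_principle[of q _ "ball 0 1" z])
      show "q holomorphic_on ball 0 1"
        unfolding q_def by (intro holomorphic_intros) (auto simp: H0 dist_norm)
      fix w assume "w \<in> ball (0::complex) 1"
      then have w: "cmod w < 1" by (simp add: dist_norm)
      then show "cmod (q w) \<le> cmod (q z)"
        using diag_op_le_dual[OF pres zf, of w] H0[OF w] u
        by (simp add: qz) (simp add: q_def F_def H_def norm_divide divide_le_eq)
    qed (use z in \<open>auto simp: dist_norm\<close>)
    then obtain c where c: "\<And>w. cmod w < 1 \<Longrightarrow> q w = c"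
      unfolding constant_on_def by (auto simp: dist_norm)
    have "poly (F + smult u H) w = 0" if w: "cmod w < 1" for w
    proof -
      have "q w = - u" using c[OF w] c[OF z(1)] qz by simp
      then show ?thesis using H0[OF w] by (simp add: q_def field_simps)
    qed
    then have "ball 0 1 \<subseteq> {w. poly (F + smult u H) w = 0}" by (auto simp: dist_norm)
    moreover have "infinite (ball (0::complex) 1)"
      using uncountable_ball[of 1 "0::complex"] countable_finite by auto
    ultimately show ?thesis
      using poly_roots_finite finite_subset by blast
  qed
  moreover have "degree (F + smult u H) \<le> n"
    unfolding F_def H_def by (intro degree_add_le degree_smult_le[THEN order_trans] degree_diag_op)
  ultimately show ?thesis
    unfolding eq zero_free_def by blast
qed

text \<open>The minimum modulus principle: \<open>m\<close> is also a lower bound of \<open>cmod f\<close> inside the disc.\<close>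

lemma zero_free_add_const:
  assumes zf: "zero_free n f" and m: "\<And>z. cmod z = 1 \<Longrightarrow> m \<le> cmod (poly f z)" and b: "cmod b < m"
  shows "zero_free n (f + [:b:])"
  unfolding zero_free_def
proof (intro conjI allI impI)
  show "degree (f + [:b:]) \<le> n"
    using zero_freeD(1)[OF zf] by (intro degree_add_le) auto
  fix z :: complex assume z: "cmod z < 1"
  have m0: "0 < m" using b norm_ge_zero[of b] by linarith
  have ne: "poly f w \<noteq> 0" if "cmod w \<le> 1" for w
  proof (cases "cmod w = 1")
    case True
    then show ?thesis using m[OF True] m0 by auto
  qed (use zero_freeD(2)[OF zf] that in auto)
  have "cmod (inverse (poly f z)) \<le> inverse m"
  proof (rule maximum_modulus_frontier[of "\<lambda>w. inverse (poly f w)" "ball 0 1"])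
    show "(\<lambda>w. inverse (poly f w)) holomorphic_on interior (ball 0 1)"
      by (intro holomorphic_intros) (auto simp: ne dist_norm)
    show "continuous_on (closure (ball 0 1)) (\<lambda>w. inverse (poly f w))"
      by (intro continuous_intros) (auto simp: ne dist_norm)
    fix w :: complex assume "w \<in> frontier (ball 0 1)"
    then have "cmod w = 1" by (simp add: frontier_ball dist_norm)
    then show "cmod (inverse (poly f w)) \<le> inverse m"
      using m m0 by (auto simp: norm_inverse intro!: le_imp_inverse_le)
  qed (use z in \<open>auto simp: dist_norm\<close>)
  then have "m \<le> cmod (poly f z)"
    using m0 ne[of z] z by (simp add: norm_inverse inverse_le_iff_le)
  then show "poly (f + [:b:]) z \<noteq> 0"
    using b by (auto simp: add_eq_0_iff2)
qed

text \<open>The comparison of an operator with its dual, evaluated at the constant polynomial \<open>1\<close>.\<close>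

lemma dual_constant_multiplier_le:
  assumes "preserves_zero_free n (dual_mult n \<nu>)"
  shows "cmod (\<nu> 0) \<le> cmod (\<nu> n)" "\<nu> n \<noteq> 0"
proof -
  have "zero_free n [:1:]" by (simp add: zero_free_const)
  from diag_op_le_dual[OF assms this, of 0] preserves_zero_freeD[OF assms this, THEN zero_freeD(2), of 0]
  show "cmod (\<nu> 0) \<le> cmod (\<nu> n)" "\<nu> n \<noteq> 0"
    by (simp_all add: poly_0_diag_op dual_mult_def)
qed

text \<open>
  The minimum enters by comparing the images of \<open>f + b\<close> for constants with \<open>cmod b < m\<close>, which are
  still free of zeros. The argument of \<open>b\<close> is free, and is chosen such that adding \<open>b\<close> lowers the
  modulus on the right as much as possible.
\<close>

lemma diag_op_add_min_le_dual:
  assumes pres: "preserves_zero_free n (dual_mult n \<nu>)" and zf: "zero_free n f"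
    and m: "0 \<le> m" "\<And>z. cmod z = 1 \<Longrightarrow> m \<le> cmod (poly f z)" and z: "cmod z \<le> 1"
  shows "cmod (poly (diag_op n \<nu> f) z) + (cmod (\<nu> n) - cmod (\<nu> 0)) * m
    \<le> cmod (poly (diag_op n (dual_mult n \<nu>) f) z)"
proof -
  define F where "F = diag_op n \<nu> f"
  define H where "H = diag_op n (dual_mult n \<nu>) f"
  define c where "c = cmod (\<nu> n) - cmod (\<nu> 0)"
  note \<nu>n = dual_constant_multiplier_le(2)[OF pres]
  have c0: "0 \<le> c" using dual_constant_multiplier_le(1)[OF pres] by (simp add: c_def)
  have shift: "zero_free n (f + [:b:])" if "cmod b < m" for b
    using zero_free_add_const[OF zf m(2) that] .
  have Hge: "m * cmod (\<nu> n) \<le> cmod (poly H w)" if w: "cmod w < 1" for w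
  proof (rule ccontr)
    assume "\<not> ?thesis"
    then have "cmod (- poly H w / cnj (\<nu> n)) < m"
      using \<nu>n by (simp add: norm_divide divide_less_eq)
    from preserves_zero_freeD[OF pres shift[OF this]] zero_freeD(2)[OF _ w]
    have "poly (diag_op n (dual_mult n \<nu>) (f + [:- poly H w / cnj (\<nu> n):])) w \<noteq> 0" by blast
    then show False
      using \<nu>n by (simp add: diag_op_add diag_op_const H_def dual_mult_def)
  qed
  \<comment> \<open>Choose \<open>b\<close> of modulus \<open>t\<close> such that \<open>b * cnj (\<nu> n)\<close> is opposite to \<open>H\<close>. By \<open>Hge\<close> the modulus on the right then drops by
    exactly \<open>t * cmod (\<nu> n)\<close>, while the one on the left drops by at most \<open>t * cmod (\<nu> 0)\<close>.\<close>
  have step: "cmod (poly F w) + t * c \<le> cmod (poly H w)" if w: "cmod w < 1" and t: "0 \<le> t" "t < m" for w t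
  proof -
    define b where "b = - of_real t * sgn (poly H w) * sgn (\<nu> n)"
    have H0: "poly H w \<noteq> 0"
      using zero_freeD(2)[OF preserves_zero_freeD[OF pres zf] w] by (simp add: H_def)
    have b: "cmod b = t" using t H0 \<nu>n by (simp add: b_def norm_mult norm_sgn)
    have "sgn (\<nu> n) * cnj (\<nu> n) = cmod (\<nu> n)"
      using \<nu>n by (simp add: sgn_eq complex_norm_square[symmetric] power2_eq_square)
    then have "b * cnj (\<nu> n) = - (of_real (t * cmod (\<nu> n)) * sgn (poly H w))"
      by (simp add: b_def mult.assoc mult_ac)
    moreover have "poly H w = of_real (cmod (poly H w)) * sgn (poly H w)"
      using H0 by (simp add: sgn_eq)
    ultimately have "poly H w + b * cnj (\<nu> n) = of_real (cmod (poly H w) - t * cmod (\<nu> n)) * sgn (poly H w)"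
      by (simp add: left_diff_distrib)
    moreover have "t * cmod (\<nu> n) \<le> cmod (poly H w)"
      using Hge[OF w] t by (intro order_trans[OF mult_right_mono Hge[OF w]]) auto
    ultimately have "cmod (poly H w + b * cnj (\<nu> n)) = cmod (poly H w) - t * cmod (\<nu> n)"
      using H0 by (simp add: norm_mult norm_sgn del: of_real_diff)
    moreover have "cmod (poly F w) - t * cmod (\<nu> 0) \<le> cmod (poly F w + \<nu> 0 * b)"
      using norm_diff_ineq[of "poly F w" "\<nu> 0 * b"] b by (simp add: norm_mult mult.commute)
    moreover have "cmod (poly F w + \<nu> 0 * b) \<le> cmod (poly H w + b * cnj (\<nu> n))"
      using diag_op_le_dual[OF pres shift, of b w] b t w
      by (simp add: diag_op_add diag_op_const F_def H_def dual_mult_def mult.commute)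
    ultimately show ?thesis by (simp add: c_def algebra_simps)
  qed
  have "cmod (poly F w) + m * c \<le> cmod (poly H w)" if w: "cmod w < 1" for w
  proof (rule ccontr)
    assume neg: "\<not> ?thesis"
    have base: "cmod (poly F w) \<le> cmod (poly H w)"
      using diag_op_le_dual[OF pres zf, of w] w by (simp add: F_def H_def)
    with neg c0 m(1) have c: "0 < c" by (cases "c = 0") auto
    define t0 where "t0 = (cmod (poly H w) - cmod (poly F w)) / c"
    have "0 \<le> t0" "t0 < m" using base neg c by (auto simp: t0_def divide_less_eq)
    then obtain t where "t0 < t" "t < m" using dense by blast
    with step[OF w, of t] c \<open>0 \<le> t0\<close> show False by (simp add: t0_def divide_less_eq)
  qed
  note interior = this
  have "continuous_on UNIV (\<lambda>w. cmod (poly F w) + m * c - cmod (poly H w))"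
    by (intro continuous_intros)
  from le_cball_of_le_ball[OF this _ z, of 0] interior
  have "cmod (poly F z) + m * c - cmod (poly H z) \<le> 0" by simp
  then show ?thesis by (simp add: F_def H_def c_def mult.commute)
qed

text \<open>Reflecting the roots of the open disc in the circle, which is division by a Blaschke product.\<close>

lemma zero_free_majorant:
  assumes "degree f \<le> n" "f \<noteq> 0"
  shows "\<exists>g. zero_free n g \<and> (\<forall>z. cmod z = 1 \<longrightarrow> cmod (poly g z) = cmod (poly f z))
    \<and> (\<forall>z. cmod z \<le> 1 \<longrightarrow> cmod (poly f z) \<le> cmod (poly g z))"
  using assms
proof (induction rule: poly_root_induct_le)
  case (const n c)
  then show ?case by (intro exI[of _ "[:c:]"]) (auto simp: zero_free_const)
next
  case (factor n r f)
  then obtain g where g: "zero_free n g" "\<And>z. cmod z = 1 \<Longrightarrow> cmod (poly g z) = cmod (poly f z)"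
    "\<And>z. cmod z \<le> 1 \<Longrightarrow> cmod (poly f z) \<le> cmod (poly g z)" by blast
  show ?case
  proof (cases "1 \<le> cmod r")
    case True
    have "zero_free (Suc n) ([:- r, 1:] * g)"
      using True g(1) zero_free_linear_factor_iff[OF zero_freeD(3)[OF g(1)]] by blast
    then show ?thesis
      using g by (intro exI[of _ "[:- r, 1:] * g"])
        (auto simp only: poly_linear_factor_mult norm_mult intro!: mult_left_mono norm_ge_zero)
  next
    case False
    define h where "h = [:1, - cnj r:] * g"
    have poly_h: "poly h z = (1 - cnj r * z) * poly g z" for z
      by (simp add: h_def algebra_simps)
    have "zero_free (Suc n) h"
      unfolding zero_free_def
    proof (intro conjI allI impI)
      show "degree h \<le> Suc n"
        unfolding h_def using degree_mult_le[of "[:1, - cnj r:]" g] zero_freeD(1)[OF g(1)]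
        by (auto split: if_splits)
      fix z :: complex assume z: "cmod z < 1"
      have "cmod (cnj r * z) < 1"
        using False z mult_left_le_one_le[of "cmod z" "cmod r"] by (simp add: norm_mult)
      then have "1 - cnj r * z \<noteq> 0" by auto
      then show "poly h z \<noteq> 0" unfolding poly_h using zero_freeD(2)[OF g(1) z] by simp
    qed
    moreover have "cmod (poly h z) = cmod (poly ([:- r, 1:] * f) z)" if "cmod z = 1" for z
      using g(2)[OF that] disc_factor_circle[OF that, of r]
      unfolding poly_linear_factor_mult poly_h norm_mult by simp
    moreover have "cmod (poly ([:- r, 1:] * f) z) \<le> cmod (poly h z)" if "cmod z \<le> 1" for z
      using g(3)[OF that] disc_factor_ge[OF that, of r] False
      unfolding poly_linear_factor_mult poly_h norm_mult by (intro mult_mono) auto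
    ultimately show ?thesis by blast
  qed
qed

section \<open>Normalised arc length on the unit circle\<close>

text \<open>
  A measure on the plane rather than integrals over \<open>{0..2 * pi}\<close>: rotations and powers
  become measure preserving maps, and no periodicity argument is needed after this section.
\<close>

definition circle_measure :: "complex measure" where
  "circle_measure = distr (uniform_measure lborel {0..2 * pi}) borel cis"

lemma sets_circle_measure [simp, measurable_cong]: "sets circle_measure = sets borel"
  by (simp add: circle_measure_def)

lemma space_circle_measure [simp]: "space circle_measure = UNIV"
  by (simp add: circle_measure_def)

lemma measurable_cis [measurable]: "cis \<in> borel_measurable borel"
  by (intro borel_measurable_continuous_onI continuous_intros)

lemma measurable_poly [measurable]: "poly (f :: complex poly) \<in> borel_measurable borel"
  by (intro borel_measurable_continuous_onI continuous_intros)

lemma prob_space_circle_measure: "prob_space circle_measure"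
  unfolding circle_measure_def
  by (intro prob_space.prob_space_distr prob_space_uniform_measure) auto

interpretation circle: prob_space circle_measure
  by (rule prob_space_circle_measure)

interpretation circle2: pair_prob_space circle_measure circle_measure ..

lemma nn_integral_circle_measure:
  assumes [measurable]: "f \<in> borel_measurable borel"
  shows "(\<integral>\<^sup>+z. f z \<partial>circle_measure)
    = (\<integral>\<^sup>+\<theta>. f (cis \<theta>) * indicator {0<..2 * pi} \<theta> \<partial>lborel) / ennreal (2 * pi)"
proof -
  have "(\<integral>\<^sup>+z. f z \<partial>circle_measure)
      = (\<integral>\<^sup>+\<theta>. f (cis \<theta>) * indicator {0..2 * pi} \<theta> \<partial>lborel) / ennreal (2 * pi)"
    by (simp add: circle_measure_def nn_integral_distr nn_integral_uniform_measure)
  also have "(\<integral>\<^sup>+\<theta>. f (cis \<theta>) * indicator {0..2 * pi} \<theta> \<partial>lborel)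
      = (\<integral>\<^sup>+\<theta>. f (cis \<theta>) * indicator {0<..2 * pi} \<theta> \<partial>lborel)"
    using AE_lborel_singleton[of 0] by (intro nn_integral_cong_AE) (auto split: split_indicator)
  finally show ?thesis .
qed

lemma integral_circle_measure:
  fixes g :: "complex \<Rightarrow> real"
  assumes [measurable]: "g \<in> borel_measurable borel"
  shows "(LINT z|circle_measure. g z) = 1 / (2 * pi) * (LINT \<theta>:{0..2 * pi}|lborel. g (cis \<theta>))"
proof -
  have "uniform_measure lborel {0..2 * pi}
      = density lborel (\<lambda>\<theta>. ennreal (indicator {0..2 * pi} \<theta> / (2 * pi)))"
    unfolding uniform_measure_def
    by (intro density_cong) (auto simp: divide_ennreal[symmetric] split: split_indicator)
  then have "(LINT z|circle_measure. g z)
      = (LINT \<theta>|lborel. (indicator {0..2 * pi} \<theta> / (2 * pi)) *\<^sub>R g (cis \<theta>))"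
    by (simp add: circle_measure_def integral_distr integral_density)
  then show ?thesis
    by (simp add: set_lebesgue_integral_def)
qed

lemma AE_circle_measure: "AE z in circle_measure. cmod z = 1"
  unfolding circle_measure_def by (subst AE_distr_iff) auto

lemma nn_integral_circle_rotate:
  assumes [measurable]: "f \<in> borel_measurable borel" and u: "cmod u = 1"
  shows "(\<integral>\<^sup>+z. f (u * z) \<partial>circle_measure) = (\<integral>\<^sup>+z. f z \<partial>circle_measure)"
proof -
  obtain \<psi> where \<psi>: "0 \<le> \<psi>" "\<psi> < 2 * pi" "u = cis \<psi>"
    using complex_unimodular_polar[OF u] by (auto simp: cis.code)
  define g where "g \<theta> = f (cis \<theta>)" for \<theta>
  have [measurable]: "g \<in> borel_measurable borel" unfolding g_def by measurable
  have "cis (2 * pi + \<theta>) = cis \<theta>" for \<theta> by (simp flip: cis_mult)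
  then have period: "g (2 * pi + \<theta>) = g \<theta>" for \<theta> by (simp only: g_def)
  have "(\<integral>\<^sup>+\<theta>. g (\<psi> + \<theta>) * indicator {0<..2 * pi} \<theta> \<partial>lborel)
      = (\<integral>\<^sup>+\<theta>. g \<theta> * indicator {\<psi><..2 * pi + \<psi>} \<theta> \<partial>lborel)"
    by (subst nn_integral_real_affine[of "\<lambda>\<theta>. g \<theta> * indicator {\<psi><..2 * pi + \<psi>} \<theta>" 1 \<psi>])
      (auto intro!: nn_integral_cong split: split_indicator)
  also have "\<dots> = (\<integral>\<^sup>+\<theta>. g \<theta> * indicator {\<psi><..2 * pi} \<theta> + g \<theta> * indicator {2 * pi<..2 * pi + \<psi>} \<theta> \<partial>lborel)"
    using \<psi> by (intro nn_integral_cong) (auto split: split_indicator)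
  also have "\<dots> = (\<integral>\<^sup>+\<theta>. g \<theta> * indicator {\<psi><..2 * pi} \<theta> \<partial>lborel)
      + (\<integral>\<^sup>+\<theta>. g \<theta> * indicator {2 * pi<..2 * pi + \<psi>} \<theta> \<partial>lborel)"
    by (intro nn_integral_add) auto
  also have "(\<integral>\<^sup>+\<theta>. g \<theta> * indicator {2 * pi<..2 * pi + \<psi>} \<theta> \<partial>lborel)
      = (\<integral>\<^sup>+\<theta>. g \<theta> * indicator {0<..\<psi>} \<theta> \<partial>lborel)"
    by (subst nn_integral_real_affine[of "\<lambda>\<theta>. g \<theta> * indicator {2 * pi<..2 * pi + \<psi>} \<theta>" 1 "2 * pi"])
      (auto simp: period intro!: nn_integral_cong split: split_indicator)
  also have "(\<integral>\<^sup>+\<theta>. g \<theta> * indicator {\<psi><..2 * pi} \<theta> \<partial>lborel) + (\<integral>\<^sup>+\<theta>. g \<theta> * indicator {0<..\<psi>} \<theta> \<partial>lborel)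
      = (\<integral>\<^sup>+\<theta>. g \<theta> * indicator {\<psi><..2 * pi} \<theta> + g \<theta> * indicator {0<..\<psi>} \<theta> \<partial>lborel)"
    by (intro nn_integral_add[symmetric]) auto
  also have "\<dots> = (\<integral>\<^sup>+\<theta>. g \<theta> * indicator {0<..2 * pi} \<theta> \<partial>lborel)"
    using \<psi> by (intro nn_integral_cong) (auto split: split_indicator)
  finally show ?thesis
    by (simp add: nn_integral_circle_measure g_def \<psi>(3) cis_mult)
qed

text \<open>
  The image under \<open>z \<mapsto> z ^ n\<close> is rotation invariant, since every \<open>v\<close> on the circle is an \<open>n\<close>-th
  power. Averaging over all rotations and exchanging the integrals identifies it, as in the
  uniqueness proof of Haar measure.
\<close>

lemma nn_integral_circle_power:
  assumes [measurable]: "f \<in> borel_measurable borel" and n: "n \<ge> 1"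
  shows "(\<integral>\<^sup>+z. f (z ^ n) \<partial>circle_measure) = (\<integral>\<^sup>+z. f z \<partial>circle_measure)"
proof -
  have rot: "(\<integral>\<^sup>+z. f (v * z ^ n) \<partial>circle_measure) = (\<integral>\<^sup>+z. f (z ^ n) \<partial>circle_measure)"
    if v: "cmod v = 1" for v
  proof -
    obtain \<psi> where "v = cis \<psi>"
      using complex_unimodular_polar[OF v] by (auto simp: cis.code)
    then have "v = cis (\<psi> / n) ^ n" using n by (auto simp: Complex.DeMoivre)
    then have "v * z ^ n = (cis (\<psi> / n) * z) ^ n" for z by (simp add: power_mult_distrib)
    then show ?thesis
      using nn_integral_circle_rotate[of "\<lambda>z. f (z ^ n)" "cis (\<psi> / n)"] by simp
  qed
  have "(\<integral>\<^sup>+z. f (z ^ n) \<partial>circle_measure)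
      = (\<integral>\<^sup>+v. (\<integral>\<^sup>+z. f (z ^ n) \<partial>circle_measure) \<partial>circle_measure)"
    by (simp add: circle.emeasure_space_1[simplified])
  also have "\<dots> = (\<integral>\<^sup>+v. (\<integral>\<^sup>+z. f (v * z ^ n) \<partial>circle_measure) \<partial>circle_measure)"
    using AE_circle_measure by (intro nn_integral_cong_AE) (auto simp: rot)
  also have "\<dots> = (\<integral>\<^sup>+z. (\<integral>\<^sup>+v. f (v * z ^ n) \<partial>circle_measure) \<partial>circle_measure)"
    by (rule circle2.Fubini') measurable
  also have "\<dots> = (\<integral>\<^sup>+z. (\<integral>\<^sup>+v. f v \<partial>circle_measure) \<partial>circle_measure)"
    using AE_circle_measure
  proof (intro nn_integral_cong_AE, elim eventually_mono)
    fix z :: complex assume "cmod z = 1"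
    then show "(\<integral>\<^sup>+v. f (v * z ^ n) \<partial>circle_measure) = (\<integral>\<^sup>+v. f v \<partial>circle_measure)"
      using nn_integral_circle_rotate[of f "z ^ n"] by (simp add: norm_power mult.commute)
  qed
  also have "\<dots> = (\<integral>\<^sup>+v. f v \<partial>circle_measure)"
    by (simp add: circle.emeasure_space_1[simplified])
  finally show ?thesis .
qed

lemma distr_circle_measure:
  assumes [measurable]: "h \<in> borel_measurable borel"
    and inv: "\<And>f. f \<in> borel_measurable borel \<Longrightarrow>
      (\<integral>\<^sup>+z. f (h z) \<partial>circle_measure) = (\<integral>\<^sup>+z. f z \<partial>circle_measure)"
  shows "distr circle_measure borel h = circle_measure"
proof (rule measure_eqI)
  fix A assume "A \<in> sets (distr circle_measure borel h)"
  then have [measurable]: "A \<in> sets borel" by simp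
  have "emeasure (distr circle_measure borel h) A = (\<integral>\<^sup>+z. indicator A z \<partial>distr circle_measure borel h)"
    by simp
  also have "\<dots> = (\<integral>\<^sup>+z. indicator A (h z) \<partial>circle_measure)"
    by (subst nn_integral_distr) auto
  also have "\<dots> = emeasure circle_measure A"
    by (subst inv) auto
  finally show "emeasure (distr circle_measure borel h) A = emeasure circle_measure A" .
qed simp

lemma circle_rotate: "cmod u = 1 \<Longrightarrow> distr circle_measure borel (\<lambda>z. u * z) = circle_measure"
  by (intro distr_circle_measure nn_integral_circle_rotate) auto

lemma circle_power: "n \<ge> 1 \<Longrightarrow> distr circle_measure borel (\<lambda>z. z ^ n) = circle_measure"
  by (intro distr_circle_measure nn_integral_circle_power) auto

lemma integral_circle_rotate:
  fixes g :: "complex \<Rightarrow> real"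
  assumes [measurable]: "g \<in> borel_measurable borel" and "cmod u = 1"
  shows "(LINT z|circle_measure. g (u * z)) = (LINT z|circle_measure. g z)"
  using integral_distr[of "\<lambda>z. u * z" circle_measure borel g] assms
  by (simp add: circle_rotate)

lemma integral_circle_power:
  fixes g :: "complex \<Rightarrow> real"
  assumes [measurable]: "g \<in> borel_measurable borel" and "n \<ge> 1"
  shows "(LINT z|circle_measure. g (z ^ n)) = (LINT z|circle_measure. g z)"
  using integral_distr[of "\<lambda>z. z ^ n" circle_measure borel g] assms
  by (simp add: circle_power)

text \<open>
  Squaring preserves the measure and the preimage of \<open>1\<close> is \<open>{1, -1}\<close>. Both points have the same
  mass, so this mass is finite and equal to its double.
\<close>

lemma emeasure_circle_singleton: "emeasure circle_measure {c} = 0"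
proof -
  have one: "emeasure circle_measure {1} = 0"
  proof -
    have "emeasure circle_measure {-1} = (\<integral>\<^sup>+z. indicator {1} (- 1 * z) \<partial>circle_measure)"
    proof -
      have "indicator {1} (- 1 * z) = (indicator {-1} z :: ennreal)" for z :: complex
        by (auto simp: minus_equation_iff split: split_indicator)
      then show ?thesis by simp
    qed
    also have "\<dots> = emeasure circle_measure {1}"
      by (subst nn_integral_circle_rotate) auto
    finally have m: "emeasure circle_measure {-1} = emeasure circle_measure {1}" .
    have "emeasure circle_measure {1} = (\<integral>\<^sup>+z. indicator {1} (z ^ 2) \<partial>circle_measure)"
      by (subst nn_integral_circle_power) auto
    also have "\<dots> = (\<integral>\<^sup>+z. indicator {1, -1} z \<partial>circle_measure)"
      by (intro nn_integral_cong) (auto simp: power2_eq_1_iff split: split_indicator)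
    also have "\<dots> = emeasure circle_measure {1} + emeasure circle_measure {-1}"
      using plus_emeasure[of "{1}" circle_measure "{-1}"] by (simp add: insert_commute)
    finally have "emeasure circle_measure {1} = emeasure circle_measure {1} + emeasure circle_measure {1}"
      unfolding m .
    then show ?thesis
      by (metis add.right_neutral circle.emeasure_finite ennreal_add_left_cancel infinity_ennreal_def)
  qed
  show ?thesis
  proof (cases "cmod c = 1")
    case True
    then have c: "c * cnj c = 1" using complex_norm_square[of c] by simp
    have "emeasure circle_measure {c} = (\<integral>\<^sup>+z. indicator {1} (cnj c * z) \<partial>circle_measure)"
    proof -
      have "cnj c * z = 1 \<longleftrightarrow> z = c" for z
        using c by (metis mult.assoc mult.commute mult.right_neutral)
      then have "indicator {1} (cnj c * z) = (indicator {c} z :: ennreal)" for z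
        by (auto split: split_indicator)
      then show ?thesis by simp
    qed
    also have "\<dots> = emeasure circle_measure {1}"
      using True by (subst nn_integral_circle_rotate) auto
    finally show ?thesis using one by simp
  next
    case False
    have "AE z in circle_measure. z \<notin> {c}"
      using AE_circle_measure by eventually_elim (use False in auto)
    then show ?thesis by (subst (asm) AE_iff_null_sets[symmetric]) auto
  qed
qed

lemma AE_circle_poly_nonzero:
  assumes "f \<noteq> 0"
  shows "AE z in circle_measure. poly f z \<noteq> 0"
proof -
  have "AE z in circle_measure. \<forall>c\<in>{c. poly f c = 0}. z \<noteq> c"
  proof (intro AE_finite_allI poly_roots_finite assms)
    fix c show "AE z in circle_measure. z \<noteq> c"
      by (rule AE_I[of _ _ "{c}"]) (auto simp: emeasure_circle_singleton)
  qed
  then show ?thesis by eventually_elim auto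
qed

section \<open>Jensen's formula for polynomials\<close>

text \<open>
  Let \<open>I a\<close> be the integral. From \<open>1 - a\<^sup>2 * z\<^sup>2 = (1 - a * z) * (1 + a * z)\<close> and the invariance
  under squaring and under \<open>z \<mapsto> - z\<close> follows \<open>I (a\<^sup>2) = 2 * I a\<close>. Iterating, \<open>2 ^ k * I a\<close> is an
  integral of the same kind with a parameter of no larger modulus and so stays bounded.
\<close>

lemma log_integral_inside:
  assumes a: "cmod a < 1"
  shows "integrable circle_measure (\<lambda>z. ln (cmod (1 - a * z)))"
    and "(LINT z|circle_measure. ln (cmod (1 - a * z))) = 0"
proof -
  define I where "I b = (LINT z|circle_measure. ln (cmod (1 - b * z)))" for b
  define C where "C = \<bar>ln (1 - cmod a)\<bar> + ln 2"
  have bound: "AE z in circle_measure. norm (ln (cmod (1 - b * z))) \<le> C" if b: "cmod b \<le> cmod a" for b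
    using AE_circle_measure
  proof eventually_elim
    fix z :: complex assume z: "cmod z = 1"
    have "1 - cmod a \<le> cmod (1 - b * z)" "cmod (1 - b * z) \<le> 2"
      using norm_triangle_ineq2[of 1 "b * z"] norm_triangle_ineq4[of 1 "b * z"] z b a
      by (simp_all add: norm_mult)
    then have "ln (1 - cmod a) \<le> ln (cmod (1 - b * z))" "ln (cmod (1 - b * z)) \<le> ln 2"
      using a by (subst ln_le_cancel_iff; linarith)+
    then show "norm (ln (cmod (1 - b * z))) \<le> C"
      unfolding C_def real_norm_def using ln_gt_zero[of "2::real"] by linarith
  qed
  have int: "integrable circle_measure (\<lambda>z. ln (cmod (1 - b * z)))" if "cmod b \<le> cmod a" for b
    using bound[OF that] by (rule circle.integrable_const_bound) measurable
  show "integrable circle_measure (\<lambda>z. ln (cmod (1 - a * z)))"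
    by (rule int) simp
  have double: "I (b\<^sup>2) = 2 * I b" if b: "cmod b \<le> cmod a" for b
  proof -
    have "I (b\<^sup>2) = (LINT z|circle_measure. ln (cmod (1 - b\<^sup>2 * z ^ 2)))"
      unfolding I_def by (rule integral_circle_power[symmetric]) auto
    also have "\<dots> = (LINT z|circle_measure. ln (cmod (1 - b * z)) + ln (cmod (1 - (- b) * z)))"
      using AE_circle_measure
    proof (intro integral_cong_AE, simp, simp, eventually_elim)
      fix z :: complex assume z: "cmod z = 1"
      have "cmod (b * z) < 1" using b a z by (simp add: norm_mult)
      then have ne: "1 - b * z \<noteq> 0" "1 - (- b) * z \<noteq> 0" by (auto simp: add_eq_0_iff)
      have "1 - b\<^sup>2 * z ^ 2 = (1 - b * z) * (1 - (- b) * z)"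
        by (simp add: algebra_simps power2_eq_square)
      then show "ln (cmod (1 - b\<^sup>2 * z ^ 2)) = ln (cmod (1 - b * z)) + ln (cmod (1 - (- b) * z))"
        using ne by (simp only: norm_mult) (rule ln_mult_pos, auto)
    qed
    also have "\<dots> = I b + I (- b)"
      unfolding I_def using b by (intro Bochner_Integration.integral_add int) auto
    also have "I (- b) = I b"
      using integral_circle_rotate[of "\<lambda>z. ln (cmod (1 - b * z))" "- 1"] by (simp add: I_def)
    finally show ?thesis by simp
  qed
  have pow: "I (a ^ (2 ^ k)) = 2 ^ k * I a" for k
  proof (induction k)
    case (Suc k)
    have "cmod (a ^ (2 ^ k)) \<le> cmod a"
      unfolding norm_power using a power_decreasing[of 1 "2 ^ k" "cmod a"] by simp
    from double[OF this] Suc show ?case by (simp flip: power_mult add: mult.commute)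
  qed simp
  have Ile: "\<bar>I b\<bar> \<le> C" if "cmod b \<le> cmod a" for b
  proof -
    have "AE z in circle_measure. ln (cmod (1 - b * z)) \<le> C"
      "AE z in circle_measure. - C \<le> ln (cmod (1 - b * z))"
      using bound[OF that] by (eventually_elim, simp)+
    then show ?thesis
      using circle.integral_le_const[OF int[OF that], of C] circle.integral_ge_const[OF int[OF that], of "- C"]
      by (simp add: I_def)
  qed
  have "I a = 0"
  proof (rule ccontr)
    assume "I a \<noteq> 0"
    then obtain k where k: "C / \<bar>I a\<bar> < 2 ^ k"
      using real_arch_pow[of 2 "C / \<bar>I a\<bar>"] by auto
    have "cmod (a ^ (2 ^ k)) \<le> cmod a"
      unfolding norm_power using a power_decreasing[of 1 "2 ^ k" "cmod a"] by simp
    from Ile[OF this] have "2 ^ k * \<bar>I a\<bar> \<le> C" by (simp add: pow abs_mult)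
    then show False using k \<open>I a \<noteq> 0\<close> by (simp add: divide_less_eq)
  qed
  then show "(LINT z|circle_measure. ln (cmod (1 - a * z))) = 0" by (simp add: I_def)
qed

text \<open>
  Integrability comes from Fatou's lemma, since \<open>ln 2 - ln (cmod (1 - r * a * z))\<close> is nonnegative with
  integral \<open>ln 2\<close> for every \<open>r < 1\<close>. Then the integral, which depends on \<open>cmod a\<close> only,
  equals its double by the squaring identity of the previous lemma.
\<close>

lemma log_integral_boundary:
  assumes a: "cmod a = 1"
  shows "integrable circle_measure (\<lambda>z. ln (cmod (1 - a * z)))"
    and "(LINT z|circle_measure. ln (cmod (1 - a * z))) = 0"
proof -
  have AEne: "AE z in circle_measure. 1 - b * z \<noteq> 0" for b
    using AE_circle_poly_nonzero[of "[:1, - b:]"] by (simp add: mult.commute)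
  have int: "integrable circle_measure (\<lambda>z. ln (cmod (1 - b * z)))" if b: "cmod b = 1" for b
  proof -
    define r where "r k = 1 - inverse (real (Suc k))" for k
    have r: "0 \<le> r k" "r k < 1" for k by (auto simp: r_def inverse_le_1_iff)
    have rlim: "r \<longlonglongrightarrow> 1" unfolding r_def
      using tendsto_diff[OF tendsto_const LIMSEQ_inverse_real_of_nat, of 1] by simp
    have rb: "cmod (of_real (r k) * b) < 1" for k using r b by (simp add: norm_mult)
    define g where "g k z = ennreal (ln 2 - ln (cmod (1 - of_real (r k) * b * z)))" for k z
    have ge: "0 \<le> ln 2 - ln (cmod (1 - of_real s * b * z))"
      if "cmod z = 1" "1 - of_real s * b * z \<noteq> 0" "0 \<le> s" "s \<le> 1" for s z
    proof -
      have "cmod (1 - of_real s * b * z) \<le> 2"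
        using norm_triangle_ineq4[of 1 "of_real s * b * z"] b that by (simp add: norm_mult)
      then have "ln (cmod (1 - of_real s * b * z)) \<le> ln 2"
        using that by (subst ln_le_cancel_iff) auto
      then show ?thesis by simp
    qed
    have gint: "(\<integral>\<^sup>+z. g k z \<partial>circle_measure) = ennreal (ln 2)" for k
    proof -
      have "(\<integral>\<^sup>+z. g k z \<partial>circle_measure)
          = ennreal (LINT z|circle_measure. ln 2 - ln (cmod (1 - of_real (r k) * b * z)))"
        unfolding g_def
      proof (rule nn_integral_eq_integral)
        show "integrable circle_measure (\<lambda>z. ln 2 - ln (cmod (1 - of_real (r k) * b * z)))"
          using log_integral_inside(1)[OF rb[of k]] by simp
        show "AE z in circle_measure. 0 \<le> ln 2 - ln (cmod (1 - of_real (r k) * b * z))"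
          using AE_circle_measure AEne[of "of_real (r k) * b"]
        proof eventually_elim
          fix z :: complex assume z: "cmod z = 1" "1 - of_real (r k) * b * z \<noteq> 0"
          show "0 \<le> ln 2 - ln (cmod (1 - of_real (r k) * b * z))"
            by (rule ge[OF z r(1) less_imp_le[OF r(2)]])
        qed
      qed
      also have "(LINT z|circle_measure. ln 2 - ln (cmod (1 - of_real (r k) * b * z))) = ln 2"
        using log_integral_inside[OF rb[of k]]
        by (simp add: circle.prob_space[simplified])
      finally show ?thesis .
    qed
    have "(\<integral>\<^sup>+z. ennreal (ln 2 - ln (cmod (1 - b * z))) \<partial>circle_measure)
        = (\<integral>\<^sup>+z. liminf (\<lambda>k. g k z) \<partial>circle_measure)"
      using AEne[of b]
    proof (intro nn_integral_cong_AE, eventually_elim)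
      fix z assume ne: "1 - b * z \<noteq> 0"
      have "(\<lambda>k. g k z) \<longlonglongrightarrow> ennreal (ln 2 - ln (cmod (1 - of_real 1 * b * z)))"
        unfolding g_def using ne by (intro tendsto_intros rlim) auto
      then show "ennreal (ln 2 - ln (cmod (1 - b * z))) = liminf (\<lambda>k. g k z)"
        by (simp add: lim_imp_Liminf)
    qed
    also have "\<dots> \<le> liminf (\<lambda>k. \<integral>\<^sup>+z. g k z \<partial>circle_measure)"
      unfolding g_def by (intro nn_integral_liminf) simp
    also have "\<dots> = ennreal (ln 2)" by (simp add: gint Liminf_const)
    finally have fin: "(\<integral>\<^sup>+z. ennreal (ln 2 - ln (cmod (1 - b * z))) \<partial>circle_measure) < \<infinity>"
      by (auto simp: top_unique less_top[symmetric])
    have "integrable circle_measure (\<lambda>z. ln 2 - ln (cmod (1 - b * z)))"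
    proof (rule integrableI_nonneg)
      show "AE z in circle_measure. 0 \<le> ln 2 - ln (cmod (1 - b * z))"
        using AE_circle_measure AEne[of b]
        by eventually_elim (use ge[of _ 1] in auto)
    qed (use fin in auto)
    from Bochner_Integration.integrable_diff[OF circle.integrable_const this, of "ln 2"]
    show ?thesis by simp
  qed
  show "integrable circle_measure (\<lambda>z. ln (cmod (1 - a * z)))" by (rule int[OF a])
  define J where "J = (LINT z|circle_measure. ln (cmod (1 - z)))"
  have J: "(LINT z|circle_measure. ln (cmod (1 - b * z))) = J" if "cmod b = 1" for b
    using integral_circle_rotate[of "\<lambda>z. ln (cmod (1 - z))" b] that by (simp add: J_def)
  have "J = (LINT z|circle_measure. ln (cmod (1 - z ^ 2)))"
    unfolding J_def by (rule integral_circle_power[symmetric]) auto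
  also have "\<dots> = (LINT z|circle_measure. ln (cmod (1 - 1 * z)) + ln (cmod (1 - (- 1) * z)))"
    using AEne[of 1] AEne[of "- 1"]
  proof (intro integral_cong_AE, simp, simp, eventually_elim)
    fix z :: complex assume ne: "1 - 1 * z \<noteq> 0" "1 - - 1 * z \<noteq> 0"
    have "1 - z ^ 2 = (1 - 1 * z) * (1 - (- 1) * z)"
      by (simp add: algebra_simps power2_eq_square)
    then show "ln (cmod (1 - z ^ 2)) = ln (cmod (1 - 1 * z)) + ln (cmod (1 - (- 1) * z))"
      using ne by (simp only: norm_mult) (rule ln_mult_pos, auto)
  qed
  also have "\<dots> = J + J"
    using int[of 1] int[of "- 1"] J[of 1] J[of "- 1"]
    by (subst Bochner_Integration.integral_add) auto
  finally have "J = 0" by simp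
  then show "(LINT z|circle_measure. ln (cmod (1 - a * z))) = 0" using J[OF a] by simp
qed

lemma log_integral_linear_factor:
  shows "integrable circle_measure (\<lambda>z. ln (cmod (z - c)))"
    and "(LINT z|circle_measure. ln (cmod (z - c))) = ln (max 1 (cmod c))"
proof -
  have *: "integrable circle_measure (\<lambda>z. ln (cmod (1 - a * z)))
      \<and> (LINT z|circle_measure. ln (cmod (1 - a * z))) = 0" if "cmod a \<le> 1" for a
    using log_integral_inside[of a] log_integral_boundary[of a] that by fastforce
  have "integrable circle_measure (\<lambda>z. ln (cmod (z - c)))
    \<and> (LINT z|circle_measure. ln (cmod (z - c))) = ln (max 1 (cmod c))"
  proof (cases "cmod c \<le> 1")
    case True
    have eq: "AE z in circle_measure. ln (cmod (1 - cnj c * z)) = ln (cmod (z - c))"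
      using AE_circle_measure by eventually_elim (simp add: disc_factor_circle)
    show ?thesis
      using *[of "cnj c"] True integrable_cong_AE[OF _ _ eq] integral_cong_AE[OF _ _ eq]
      by (simp add: max_absorb1)
  next
    case False
    then have c: "c \<noteq> 0" by auto
    have AE: "AE z in circle_measure. z - c \<noteq> 0"
      using AE_circle_poly_nonzero[of "[:- c, 1:]"] by simp
    have eq: "AE z in circle_measure. ln (cmod c) + ln (cmod (1 - inverse c * z)) = ln (cmod (z - c))"
      using AE
    proof eventually_elim
      fix z assume "z - c \<noteq> 0"
      moreover have "c * (1 - inverse c * z) = - (z - c)" using c by (simp add: algebra_simps)
      ultimately have "cmod c * cmod (1 - inverse c * z) = cmod (z - c)" "1 - inverse c * z \<noteq> 0"
        by (metis norm_mult norm_minus_cancel, force)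
      then show "ln (cmod c) + ln (cmod (1 - inverse c * z)) = ln (cmod (z - c))"
        using c by (simp flip: ln_mult_pos)
    qed
    have "cmod (inverse c) \<le> 1" using False by (simp add: norm_inverse inverse_le_1_iff)
    from *[OF this] show ?thesis
      using False integrable_cong_AE[OF _ _ eq] integral_cong_AE[OF _ _ eq]
      by (simp add: circle.prob_space[simplified] max_absorb2)
  qed
  then show "integrable circle_measure (\<lambda>z. ln (cmod (z - c)))"
    and "(LINT z|circle_measure. ln (cmod (z - c))) = ln (max 1 (cmod c))" by auto
qed

lemma log_integral_linear:
  assumes "a \<noteq> 0 \<or> b \<noteq> 0"
  shows "integrable circle_measure (\<lambda>u. ln (cmod (a + u * b)))"
    and "(LINT u|circle_measure. ln (cmod (a + u * b))) = ln (max (cmod a) (cmod b))"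
proof -
  have "integrable circle_measure (\<lambda>u. ln (cmod (a + u * b)))
    \<and> (LINT u|circle_measure. ln (cmod (a + u * b))) = ln (max (cmod a) (cmod b))"
  proof (cases "b = 0")
    case True
    then show ?thesis by (simp add: circle.prob_space[simplified] max_absorb1)
  next
    case False
    have AE: "AE u in circle_measure. u - (- a / b) \<noteq> 0"
      using AE_circle_poly_nonzero[of "[:- (- a / b), 1:]"] by (simp add: add.commute)
    have eq: "AE u in circle_measure. ln (cmod b) + ln (cmod (u - (- a / b))) = ln (cmod (a + u * b))"
      using AE
    proof eventually_elim
      fix u assume "u - (- a / b) \<noteq> 0"
      moreover have "b * (u - (- a / b)) = a + u * b" using False by (simp add: field_simps)
      ultimately show "ln (cmod b) + ln (cmod (u - (- a / b))) = ln (cmod (a + u * b))"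
        using False by (metis ln_mult_pos norm_mult zero_less_norm_iff)
    qed
    have "ln (cmod b) + ln (max 1 (cmod (- a / b))) = ln (cmod b * max 1 (cmod (- a / b)))"
      using False by (intro ln_mult_pos[symmetric]) auto
    also have "cmod b * max 1 (cmod (- a / b)) = max (cmod a) (cmod b)"
      using False by (simp add: norm_divide max_def field_simps)
    finally show ?thesis
      using log_integral_linear_factor[of "- a / b"]
        integrable_cong_AE[OF _ _ eq] integral_cong_AE[OF _ _ eq]
      by (simp add: circle.prob_space[simplified])
  qed
  then show "integrable circle_measure (\<lambda>u. ln (cmod (a + u * b)))"
    and "(LINT u|circle_measure. ln (cmod (a + u * b))) = ln (max (cmod a) (cmod b))" by auto
qed

text \<open>
  Jensen's formula without zeros in the open disc: zeros on the circle do no harm,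
  because \<open>ln (max 1 (cmod r)) = ln (cmod r)\<close> also holds for \<open>cmod r = 1\<close>.
\<close>

lemma jensen_zero_free:
  assumes "zero_free n f"
  shows "integrable circle_measure (\<lambda>z. ln (cmod (poly f z)))
    \<and> (LINT z|circle_measure. ln (cmod (poly f z))) = ln (cmod (poly f 0))"
  using assms
proof (induction rule: zero_free_induct)
  case (const n c)
  then show ?case by (simp add: circle.prob_space[simplified])
next
  case (factor n r g)
  have "AE z in circle_measure. z - r \<noteq> 0"
    using AE_circle_poly_nonzero[of "[:- r, 1:]"] by simp
  then have eq: "AE z in circle_measure. ln (cmod (z - r)) + ln (cmod (poly g z))
      = ln (cmod (poly ([:- r, 1:] * g) z))"
    using AE_circle_poly_nonzero[OF zero_freeD(3)[OF factor(2)]]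
    by eventually_elim (simp only: poly_linear_factor_mult norm_mult, subst ln_mult_pos, auto)
  have "ln (cmod r) + ln (cmod (poly g 0)) = ln (cmod r * cmod (poly g 0))"
    using factor zero_freeD(2)[OF factor(2), of 0] by (intro ln_mult_pos[symmetric]) auto
  also have "cmod r * cmod (poly g 0) = cmod (poly ([:- r, 1:] * g) 0)"
    by (simp add: norm_mult)
  finally show ?case
    using log_integral_linear_factor[of r] factor integrable_cong_AE[OF _ _ eq] integral_cong_AE[OF _ _ eq]
    by (simp add: max_absorb2)
qed

lemma integrable_log_poly:
  assumes "f \<noteq> 0"
  shows "integrable circle_measure (\<lambda>z. ln (cmod (poly f z)))"
proof -
  obtain g where g: "zero_free (degree f) g" "\<And>z. cmod z = 1 \<Longrightarrow> cmod (poly g z) = cmod (poly f z)"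
    using zero_free_majorant[OF order_refl assms] by blast
  have "AE z in circle_measure. ln (cmod (poly g z)) = ln (cmod (poly f z))"
    using AE_circle_measure by eventually_elim (simp add: g)
  from integrable_cong_AE[OF _ _ this] jensen_zero_free[OF g(1)] show ?thesis by simp
qed

section \<open>Arestov's inequality\<close>

lemma poly_bounded_disc:
  fixes f :: "complex poly"
  obtains K where "0 \<le> K" "\<And>z. cmod z \<le> 1 \<Longrightarrow> cmod (poly f z) \<le> K"
proof -
  have "compact (poly f ` cball 0 1)"
    by (intro compact_continuous_image continuous_intros compact_cball)
  then obtain B where "\<forall>w\<in>poly f ` cball 0 1. cmod w \<le> B"
    using compact_imp_bounded bounded_iff by metis
  then have "cmod (poly f z) \<le> max 0 B" if "cmod z \<le> 1" for z
    using that by (auto simp: dist_norm le_max_iff_disj)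
  then show ?thesis by (intro that[of "max 0 B"]) auto
qed

text \<open>
  The constant term of an image is \<open>\<kappa> 0\<close> times that of the polynomial, so \<open>\<kappa> 0\<close> alone decides which alternative
  holds. In the second case, \<open>f\<close> is the difference of two polynomials without zeros, \<open>f + c\<close> and \<open>c\<close>
  for a large constant \<open>c\<close>.
\<close>

lemma preserves_or_annihilates:
  assumes "\<And>f. zero_free n f \<Longrightarrow> zero_free n (diag_op n \<kappa> f) \<or> diag_op n \<kappa> f = 0"
  shows "preserves_zero_free n \<kappa> \<or> (\<forall>f. degree f \<le> n \<longrightarrow> diag_op n \<kappa> f = 0)"
proof (cases "\<kappa> 0 = 0")
  case False
  have "diag_op n \<kappa> f \<noteq> 0" if "zero_free n f" for f
    using zero_freeD(2)[OF that, of 0] False poly_0_diag_op[of n \<kappa> f] by auto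
  then show ?thesis using assms by (auto simp: preserves_zero_free_def)
next
  case True
  have null: "diag_op n \<kappa> f = 0" if "zero_free n f" for f
    using assms[OF that] zero_freeD(2)[of n "diag_op n \<kappa> f" 0] poly_0_diag_op[of n \<kappa> f] True by auto
  have "diag_op n \<kappa> f = 0" if deg: "degree f \<le> n" for f
  proof -
    obtain B where "0 \<le> B" and B: "\<And>z. cmod z \<le> 1 \<Longrightarrow> cmod (poly f z) \<le> B"
      using poly_bounded_disc[of f] by blast
    have "zero_free n ([:of_real (B + 1):] + f)"
      unfolding zero_free_def
    proof (intro conjI allI impI)
      show "degree ([:of_real (B + 1):] + f) \<le> n" using deg by (intro degree_add_le) auto
      fix z :: complex assume "cmod z < 1"
      then have "cmod (poly f z) < cmod (of_real (B + 1))"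
        using B[of z] \<open>0 \<le> B\<close> by simp
      then show "poly ([:of_real (B + 1):] + f) z \<noteq> 0"
        by (auto simp: add_eq_0_iff simp del: of_real_add)
    qed
    from null[OF this] null[OF zero_free_const[of "of_real (B + 1)" n]] \<open>0 \<le> B\<close> show ?thesis
      by (simp add: diag_op_add del: of_real_add)
  qed
  then show ?thesis by blast
qed

lemma preserves_zero_free_0:
  assumes "preserves_zero_free n \<kappa>"
  shows "\<kappa> 0 \<noteq> 0"
  using zero_freeD(2)[OF preserves_zero_freeD[OF assms zero_free_const[of 1]], of 0]
  by (simp add: poly_0_diag_op)

text \<open>
  Arestov's inequality for the exponent \<open>0\<close>. Reflecting the roots does not change \<open>cmod f\<close> on
  the circle and does not lower the modulus of the image; for polynomials without zeros Jensen's
  formula reduces both integrals to the constant terms.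
\<close>

lemma mahler_measure_le:
  assumes pres: "preserves_zero_free n \<kappa>" and f: "degree f \<le> n" "f \<noteq> 0" "diag_op n \<kappa> f \<noteq> 0"
  shows "(LINT z|circle_measure. ln (cmod (poly (diag_op n \<kappa> f) z)))
    \<le> ln (cmod (\<kappa> 0)) + (LINT z|circle_measure. ln (cmod (poly f z)))"
proof -
  obtain g where g: "zero_free n g" "\<And>z. cmod z = 1 \<Longrightarrow> cmod (poly g z) = cmod (poly f z)"
    "\<And>z. cmod z \<le> 1 \<Longrightarrow> cmod (poly f z) \<le> cmod (poly g z)"
    using zero_free_majorant[OF f(1,2)] by blast
  have Tg: "zero_free n (diag_op n \<kappa> g)" by (rule preserves_zero_freeD[OF pres g(1)])
  have "(LINT z|circle_measure. ln (cmod (poly (diag_op n \<kappa> f) z)))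
      \<le> (LINT z|circle_measure. ln (cmod (poly (diag_op n \<kappa> g) z)))"
  proof (intro integral_mono_AE integrable_log_poly f zero_freeD(3)[OF Tg])
    show "AE z in circle_measure. ln (cmod (poly (diag_op n \<kappa> f) z)) \<le> ln (cmod (poly (diag_op n \<kappa> g) z))"
      using AE_circle_measure AE_circle_poly_nonzero[OF f(3)]
    proof eventually_elim
      fix z :: complex assume z: "cmod z = 1" "poly (diag_op n \<kappa> f) z \<noteq> 0"
      have "cmod (poly (diag_op n \<kappa> f) z) \<le> cmod (poly (diag_op n \<kappa> g) z)"
        using z(1) by (intro diag_op_mono[OF pres g(1) f(1)] g(3)) auto
      then show "ln (cmod (poly (diag_op n \<kappa> f) z)) \<le> ln (cmod (poly (diag_op n \<kappa> g) z))"
        using z(2) by (intro ln_mono) auto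
    qed
  qed
  also have "\<dots> = ln (cmod (\<kappa> 0) * cmod (poly g 0))"
    using jensen_zero_free[OF Tg] by (simp add: poly_0_diag_op norm_mult)
  also have "\<dots> = ln (cmod (\<kappa> 0)) + ln (cmod (poly g 0))"
    using preserves_zero_free_0[OF pres] zero_freeD(2)[OF g(1), of 0] by (intro ln_mult_pos) auto
  also have "ln (cmod (poly g 0)) = (LINT z|circle_measure. ln (cmod (poly g z)))"
    using jensen_zero_free[OF g(1)] by simp
  also have "\<dots> = (LINT z|circle_measure. ln (cmod (poly f z)))"
    using AE_circle_measure by (intro integral_cong_AE) (auto elim!: eventually_mono simp: g(2))
  finally show ?thesis .
qed

text \<open>
  For fixed \<open>z\<close> the integral over \<open>u\<close> is known in closed form and bounded. It controls the
  absolute value as well, because \<open>\<bar>ln x\<bar> \<le> 2 * L - ln x\<close> whenever \<open>ln x \<le> L\<close> and \<open>0 \<le> L\<close>.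
\<close>

lemma integrable_log_pair:
  fixes f :: "complex poly"
  assumes b: "b \<noteq> 0"
  shows "integrable (circle_measure \<Otimes>\<^sub>M circle_measure) (\<lambda>(z, u). ln (cmod (poly f z + u * b)))"
proof -
  obtain K where K: "0 \<le> K" "\<And>z. cmod z = 1 \<Longrightarrow> cmod (poly f z) \<le> K"
    using poly_bounded_disc[of f] by (metis order_refl)
  define L where "L = ln (K + cmod b + 1)"
  have L0: "0 \<le> L" using K(1) by (simp add: L_def)
  have upper: "ln (cmod (poly f z + u * b)) \<le> L" if "cmod z = 1" "cmod u = 1" for z u
  proof (cases "poly f z + u * b = 0")
    case False
    have "cmod (poly f z + u * b) \<le> K + cmod b + 1"
      using norm_triangle_ineq[of "poly f z" "u * b"] K(2)[OF that(1)] that(2) by (simp add: norm_mult)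
    then show ?thesis unfolding L_def using False by (intro ln_mono) auto
  qed (use L0 in simp)
  show ?thesis
  proof (rule circle2.Fubini_integrable)
    show "(\<lambda>(z, u). ln (cmod (poly f z + u * b))) \<in> borel_measurable (circle_measure \<Otimes>\<^sub>M circle_measure)"
      by measurable
    show "AE z in circle_measure. integrable circle_measure (\<lambda>u. case (z, u) of (z, u) \<Rightarrow> ln (cmod (poly f z + u * b)))"
      using log_integral_linear(1)[of _ b] b by simp
    show "integrable circle_measure (\<lambda>z. LINT u|circle_measure. norm (case (z, u) of (z, u) \<Rightarrow> ln (cmod (poly f z + u * b))))"
    proof (rule circle.integrable_const_bound[where B = "2 * L - ln (cmod b)"])
      show "AE z in circle_measure. norm (LINT u|circle_measure. norm (case (z, u) of (z, u) \<Rightarrow> ln (cmod (poly f z + u * b))))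
          \<le> 2 * L - ln (cmod b)"
        using AE_circle_measure
      proof eventually_elim
        fix z :: complex assume z: "cmod z = 1"
        note int = log_integral_linear[of "poly f z" b]
        have "(LINT u|circle_measure. norm (ln (cmod (poly f z + u * b))))
            \<le> (LINT u|circle_measure. 2 * L - ln (cmod (poly f z + u * b)))"
        proof (intro integral_mono_AE)
          show "AE u in circle_measure. norm (ln (cmod (poly f z + u * b))) \<le> 2 * L - ln (cmod (poly f z + u * b))"
            using AE_circle_measure
          proof eventually_elim
            fix u :: complex assume "cmod u = 1"
            from upper[OF z this] L0
            show "norm (ln (cmod (poly f z + u * b))) \<le> 2 * L - ln (cmod (poly f z + u * b))"
              by (simp add: abs_le_iff)
          qed
        qed (use int b in auto)
        also have "\<dots> = 2 * L - ln (max (cmod (poly f z)) (cmod b))"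
          using int b by (simp add: circle.prob_space[simplified])
        also have "\<dots> \<le> 2 * L - ln (cmod b)"
          using b by (simp add: ln_mono)
        finally show "norm (LINT u|circle_measure. norm (case (z, u) of (z, u) \<Rightarrow> ln (cmod (poly f z + u * b))))
          \<le> 2 * L - ln (cmod b)"
          by simp
      qed
    qed measurable
  qed
qed

lemma integrable_log_max:
  fixes f :: "complex poly"
  assumes "s > 0"
  shows "integrable circle_measure (\<lambda>z. ln (max (cmod (poly f z)) s))"
proof -
  obtain K where K: "0 \<le> K" "\<And>z. cmod z = 1 \<Longrightarrow> cmod (poly f z) \<le> K"
    using poly_bounded_disc[of f] by (metis order_refl)
  show ?thesis
  proof (rule circle.integrable_const_bound[where B = "\<bar>ln s\<bar> + \<bar>ln (max K s)\<bar>"])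
    show "AE z in circle_measure. norm (ln (max (cmod (poly f z)) s)) \<le> \<bar>ln s\<bar> + \<bar>ln (max K s)\<bar>"
      using AE_circle_measure
    proof eventually_elim
      fix z :: complex assume "cmod z = 1"
      from K(2)[OF this] have "ln s \<le> ln (max (cmod (poly f z)) s)" "ln (max (cmod (poly f z)) s) \<le> ln (max K s)"
        using assms by (intro ln_mono; auto simp: less_max_iff_disj)+
      then show "norm (ln (max (cmod (poly f z)) s)) \<le> \<bar>ln s\<bar> + \<bar>ln (max K s)\<bar>" by simp
    qed
  qed measurable
qed

lemma log_integral_average:
  fixes f :: "complex poly"
  assumes b: "b \<noteq> 0"
  shows "integrable circle_measure (\<lambda>u. LINT z|circle_measure. ln (cmod (poly f z + u * b)))"
    and "(LINT u|circle_measure. LINT z|circle_measure. ln (cmod (poly f z + u * b)))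
      = (LINT z|circle_measure. ln (max (cmod (poly f z)) (cmod b)))"
proof -
  note int = integrable_log_pair[OF b, of f]
  show "integrable circle_measure (\<lambda>u. LINT z|circle_measure. ln (cmod (poly f z + u * b)))"
    using circle2.integrable_snd[OF int] .
  have "(LINT u|circle_measure. LINT z|circle_measure. ln (cmod (poly f z + u * b)))
      = (LINT z|circle_measure. LINT u|circle_measure. ln (cmod (poly f z + u * b)))"
    using circle2.Fubini_integral[OF int] .
  then show "(LINT u|circle_measure. LINT z|circle_measure. ln (cmod (poly f z + u * b)))
      = (LINT z|circle_measure. ln (max (cmod (poly f z)) (cmod b)))"
    using b by (simp add: log_integral_linear)
qed

text \<open>
  The inequality between Mahler measures is applied to \<open>f + u * s\<close> and averaged over \<open>u\<close>; by Jensen's formula,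
  averaging \<open>ln (cmod (x + u * s))\<close> over \<open>u\<close> gives \<open>ln (max (cmod x) s)\<close>.
\<close>

lemma log_max_integral_le:
  assumes pres: "preserves_zero_free n \<kappa>" and f: "degree f \<le> n" and s: "s > 0"
  shows "(LINT z|circle_measure. ln (max (cmod (poly (diag_op n \<kappa> f) z)) (cmod (\<kappa> 0) * s)))
    \<le> ln (cmod (\<kappa> 0)) + (LINT z|circle_measure. ln (max (cmod (poly f z)) s))"
proof -
  define b where "b = complex_of_real s"
  have b: "b \<noteq> 0" "cmod b = s" using s by (auto simp: b_def)
  note \<kappa>0 = preserves_zero_free_0[OF pres]
  have b': "\<kappa> 0 * b \<noteq> 0" "cmod (\<kappa> 0 * b) = cmod (\<kappa> 0) * s"
    using b \<kappa>0 by (auto simp: norm_mult)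
  have "(LINT z|circle_measure. ln (max (cmod (poly (diag_op n \<kappa> f) z)) (cmod (\<kappa> 0) * s)))
      = (LINT u|circle_measure. LINT z|circle_measure. ln (cmod (poly (diag_op n \<kappa> f) z + u * (\<kappa> 0 * b))))"
    using log_integral_average(2)[OF b'(1)] by (simp add: b'(2))
  also have "\<dots> \<le> (LINT u|circle_measure. ln (cmod (\<kappa> 0)) + (LINT z|circle_measure. ln (cmod (poly f z + u * b))))"
  proof (intro integral_mono_AE)
    have ne: "AE u in circle_measure. u \<noteq> c" for c
      by (rule AE_I[of _ _ "{c}"]) (auto simp: emeasure_circle_singleton)
    show "AE u in circle_measure. (LINT z|circle_measure. ln (cmod (poly (diag_op n \<kappa> f) z + u * (\<kappa> 0 * b))))
        \<le> ln (cmod (\<kappa> 0)) + (LINT z|circle_measure. ln (cmod (poly f z + u * b)))"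
      \<comment> \<open>Away from this \<open>u\<close> the constant terms of \<open>f + u * b\<close> and of its image are not zero, so neither
      polynomial is zero and \<open>ln 0\<close> does not interfere.\<close>
      using ne[of "- coeff f 0 / b"]
    proof eventually_elim
      fix u assume u: "u \<noteq> - coeff f 0 / b"
      have T: "diag_op n \<kappa> (f + [:u * b:]) = diag_op n \<kappa> f + [:\<kappa> 0 * (u * b):]"
        by (simp add: diag_op_add diag_op_const)
      have c0: "coeff f 0 + u * b \<noteq> 0" using u b by (auto simp: field_simps add_eq_0_iff)
      have "coeff (f + [:u * b:]) 0 \<noteq> 0" using c0 by simp
      moreover have "coeff (diag_op n \<kappa> (f + [:u * b:])) 0 \<noteq> 0"
        using c0 \<kappa>0 by (simp add: coeff_diag_op)
      ultimately have ne: "f + [:u * b:] \<noteq> 0" "diag_op n \<kappa> (f + [:u * b:]) \<noteq> 0"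
        using coeff_0 by metis+
      have "degree (f + [:u * b:]) \<le> n" using f by (intro degree_add_le) auto
      from mahler_measure_le[OF pres this ne]
      show "(LINT z|circle_measure. ln (cmod (poly (diag_op n \<kappa> f) z + u * (\<kappa> 0 * b))))
          \<le> ln (cmod (\<kappa> 0)) + (LINT z|circle_measure. ln (cmod (poly f z + u * b)))"
        unfolding T by (simp add: mult.left_commute)
    qed
  qed (use log_integral_average(1)[OF b'(1)] log_integral_average(1)[OF b(1)] in auto)
  also have "\<dots> = ln (cmod (\<kappa> 0)) + (LINT z|circle_measure. ln (max (cmod (poly f z)) s))"
    using log_integral_average[OF b(1), of f] by (simp add: circle.prob_space[simplified] b(2))
  finally show ?thesis .
qed

text \<open>
  With \<open>a = exp (- t)\<close> this is \<open>x powr p = \<integral> p\<^sup>2 * a powr (p - 1) * ln (max 1 (x / a)) da\<close> over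
  \<open>a > 0\<close>, so an inequality for all the functions \<open>ln (max x a)\<close> carries over to \<open>x powr p\<close>.
\<close>

lemma powr_as_log_superposition:
  assumes p: "p > 0" and x: "x \<ge> 0"
  shows "(\<integral>\<^sup>+t. ennreal (p\<^sup>2 * exp (- p * t) * (ln (max x (exp (- t))) + t)) \<partial>lborel) = ennreal (x powr p)"
proof (cases "x = 0")
  case True
  then show ?thesis by (simp add: max_absorb2)
next
  case False
  then have x: "x > 0" using assms by simp
  \<comment> \<open>An antiderivative of \<open>p\<^sup>2 * exp (- p * t) * (t + ln x)\<close>; the integrand vanishes for \<open>t < - ln x\<close>.\<close>
  define F where "F t = - (p * (t + ln x) + 1) * exp (- p * t)" for t
  have "ln (max x (exp (- t))) + t = max 0 (t + ln x)" for t
  proof -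
    have "exp (- t) \<le> x \<longleftrightarrow> - t \<le> ln x" using x by (simp add: ln_ge_iff)
    then show ?thesis by (auto simp: max_def)
  qed
  then have "(\<integral>\<^sup>+t. ennreal (p\<^sup>2 * exp (- p * t) * (ln (max x (exp (- t))) + t)) \<partial>lborel)
      = (\<integral>\<^sup>+t. ennreal (p\<^sup>2 * exp (- p * t) * (t + ln x)) * indicator {- ln x..} t \<partial>lborel)"
    by (intro nn_integral_cong) (auto simp: max_def split: split_indicator)
  also have "\<dots> = ennreal (0 - F (- ln x))"
  proof (rule nn_integral_FTC_atLeast)
    show "(F has_real_derivative p\<^sup>2 * exp (- p * t) * (t + ln x)) (at t)" for t
      unfolding F_def by (auto intro!: derivative_eq_intros simp: algebra_simps power2_eq_square)
    show "(F \<longlongrightarrow> 0) at_top"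
      unfolding F_def using p by real_asymp
  qed (use p in auto)
  also have "0 - F (- ln x) = x powr p" using x by (simp add: F_def powr_def)
  finally show ?thesis .
qed

text \<open>
  The powers of both sides are superpositions of the functions compared in \<open>log_max_integral_le\<close>;
  the threshold \<open>s\<close> there becomes \<open>exp (- t)\<close>.
\<close>

theorem arestov_inequality:
  assumes pres: "preserves_zero_free n \<kappa>" and f: "degree f \<le> n" and p: "p > 0"
  shows "(\<integral>\<^sup>+z. ennreal (cmod (poly (diag_op n \<kappa> f) z) powr p) \<partial>circle_measure)
    \<le> ennreal (cmod (\<kappa> 0) powr p) * (\<integral>\<^sup>+z. ennreal (cmod (poly f z) powr p) \<partial>circle_measure)"
proof -
  interpret lc: pair_sigma_finite circle_measure "lborel :: real measure" ..
  define c where "c = cmod (\<kappa> 0)"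
  have c: "c > 0" using preserves_zero_free_0[OF pres] by (simp add: c_def)
  define g where "g = smult (1 / of_real c) (diag_op n \<kappa> f)"
  have g: "cmod (poly (diag_op n \<kappa> f) z) = c * cmod (poly g z)" for z
    using c by (simp add: g_def norm_divide norm_mult)
  define \<phi> where "\<phi> t x = ln (max x (exp (- t))) + t" for t x :: real
  have \<phi>0: "0 \<le> \<phi> t x" for t x
  proof -
    have "ln (exp (- t)) \<le> ln (max x (exp (- t)))" by (intro ln_mono) auto
    then show ?thesis by (simp add: \<phi>_def)
  qed
  have \<phi>int: "integrable circle_measure (\<lambda>z. \<phi> t (cmod (poly h z)))" for t and h :: "complex poly"
    unfolding \<phi>_def using integrable_log_max[of "exp (- t)" h] by simp
  have "(LINT z|circle_measure. \<phi> t (cmod (poly g z))) \<le> (LINT z|circle_measure. \<phi> t (cmod (poly f z)))" for t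
  proof -
    have "ln (max (cmod (poly (diag_op n \<kappa> f) z)) (c * exp (- t)))
        = ln c + ln (max (cmod (poly g z)) (exp (- t)))" for z
    proof -
      have "max (cmod (poly (diag_op n \<kappa> f) z)) (c * exp (- t)) = c * max (cmod (poly g z)) (exp (- t))"
        using c by (simp add: g max_mult_distrib_left)
      then show ?thesis using c by (simp add: ln_mult_pos less_max_iff_disj)
    qed
    with log_max_integral_le[OF pres f, of "exp (- t)"]
    have "(LINT z|circle_measure. ln (max (cmod (poly g z)) (exp (- t))))
        \<le> (LINT z|circle_measure. ln (max (cmod (poly f z)) (exp (- t))))"
      using integrable_log_max[of "exp (- t)" g]
      by (simp add: c_def[symmetric] circle.prob_space[simplified])
    then show ?thesis
      unfolding \<phi>_def using integrable_log_max[of "exp (- t)" g] integrable_log_max[of "exp (- t)" f]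
      by (simp add: circle.prob_space[simplified])
  qed
  then have le: "(\<integral>\<^sup>+z. ennreal (\<phi> t (cmod (poly g z))) \<partial>circle_measure)
      \<le> (\<integral>\<^sup>+z. ennreal (\<phi> t (cmod (poly f z))) \<partial>circle_measure)" for t
    using \<phi>int \<phi>0 by (simp add: nn_integral_eq_integral ennreal_leI)
  have rep: "(\<integral>\<^sup>+z. ennreal (cmod (poly h z) powr p) \<partial>circle_measure)
      = (\<integral>\<^sup>+t. ennreal (p\<^sup>2 * exp (- p * t)) * (\<integral>\<^sup>+z. ennreal (\<phi> t (cmod (poly h z))) \<partial>circle_measure) \<partial>lborel)"
    for h :: "complex poly"
  proof -
    have "(\<integral>\<^sup>+z. ennreal (cmod (poly h z) powr p) \<partial>circle_measure)
        = (\<integral>\<^sup>+z. (\<integral>\<^sup>+t. ennreal (p\<^sup>2 * exp (- p * t) * \<phi> t (cmod (poly h z))) \<partial>lborel) \<partial>circle_measure)"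
      unfolding \<phi>_def using p by (simp only: powr_as_log_superposition norm_ge_zero)
    also have "\<dots> = (\<integral>\<^sup>+t. (\<integral>\<^sup>+z. ennreal (p\<^sup>2 * exp (- p * t) * \<phi> t (cmod (poly h z))) \<partial>circle_measure) \<partial>lborel)"
      unfolding \<phi>_def by (rule lc.Fubini'[symmetric]) measurable
    also have "\<dots> = (\<integral>\<^sup>+t. ennreal (p\<^sup>2 * exp (- p * t)) * (\<integral>\<^sup>+z. ennreal (\<phi> t (cmod (poly h z))) \<partial>circle_measure) \<partial>lborel)"
      by (intro nn_integral_cong, subst nn_integral_cmult[symmetric]) (auto simp: \<phi>_def ennreal_mult')
    finally show ?thesis .
  qed
  have "(\<integral>\<^sup>+z. ennreal (cmod (poly (diag_op n \<kappa> f) z) powr p) \<partial>circle_measure)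
      = ennreal (c powr p) * (\<integral>\<^sup>+z. ennreal (cmod (poly g z) powr p) \<partial>circle_measure)"
    using c by (subst nn_integral_cmult[symmetric]) (auto simp: g powr_mult ennreal_mult')
  also have "(\<integral>\<^sup>+z. ennreal (cmod (poly g z) powr p) \<partial>circle_measure)
      \<le> (\<integral>\<^sup>+z. ennreal (cmod (poly f z) powr p) \<partial>circle_measure)"
    unfolding rep by (intro nn_integral_mono mult_left_mono le) simp
  finally show ?thesis by (simp add: c_def mult_left_mono)
qed

section \<open>The norm inequality and its extremal binomials\<close>

lemma coeff_op_B: "coeff (op_B n l0 l1 l2 f) k = mult_B n l0 l1 l2 k * coeff f k"
proof -
  have "[:0, of_nat n / 2:] * h = smult (of_nat n / 2) (pCons 0 h)" for h :: "complex poly"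
    by simp
  then show ?thesis
    by (cases k; cases "k - 1")
      (simp_all add: op_B_def mult_B_def power2_eq_square coeff_pderiv coeff_pCons fact_2 field_simps)
qed

lemma op_B_dilation_diff:
  assumes "degree f \<le> n"
  shows "op_B n l0 l1 l2 (f \<circ>\<^sub>p [:0, of_real R:]) - smult \<alpha> (op_B n l0 l1 l2 f)
    = diag_op n (\<lambda>k. mult_B n l0 l1 l2 k * (of_real R ^ k - \<alpha>)) f"
proof (rule poly_eqI)
  fix k
  have "coeff (f \<circ>\<^sub>p [:0, of_real R:]) k = of_real R ^ k * coeff f k"
    by (simp add: coeff_pcompose_linear)
  then show "coeff (op_B n l0 l1 l2 (f \<circ>\<^sub>p [:0, of_real R:]) - smult \<alpha> (op_B n l0 l1 l2 f)) k
      = coeff (diag_op n (\<lambda>k. mult_B n l0 l1 l2 k * (of_real R ^ k - \<alpha>)) f) k"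
    using assms by (auto simp: coeff_op_B coeff_diag_op coeff_eq_0 algebra_simps)
qed

lemma mult_B_0: "mult_B n l0 l1 l2 0 = l0"
  by (simp add: mult_B_def)

lemma mult_B_degree: "mult_B n l0 l1 l2 n = Lambda_B n l0 l1 l2"
  by (simp add: mult_B_def Lambda_B_def power2_eq_square power3_eq_cube algebra_simps)

lemma circle_norm_0:
  "Q \<noteq> 0 \<Longrightarrow> circle_norm 0 Q = exp (LINT z|circle_measure. ln (cmod (poly Q z)))"
  by (simp add: circle_norm_def integral_circle_measure)

lemma circle_norm_pos:
  "p \<noteq> 0 \<Longrightarrow> circle_norm p Q = (LINT z|circle_measure. cmod (poly Q z) powr p) powr (1 / p)"
  by (simp add: circle_norm_def integral_circle_measure)

lemma nn_integral_circle_powr: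
  fixes Q :: "complex poly"
  assumes "p > 0"
  shows "(\<integral>\<^sup>+z. ennreal (cmod (poly Q z) powr p) \<partial>circle_measure)
    = ennreal (LINT z|circle_measure. cmod (poly Q z) powr p)"
proof (rule nn_integral_eq_integral)
  obtain K where K: "0 \<le> K" "\<And>z. cmod z = 1 \<Longrightarrow> cmod (poly Q z) \<le> K"
    using poly_bounded_disc[of Q] by (metis order_refl)
  show "integrable circle_measure (\<lambda>z. cmod (poly Q z) powr p)"
  proof (rule circle.integrable_const_bound[where B = "K powr p"])
    show "AE z in circle_measure. norm (cmod (poly Q z) powr p) \<le> K powr p"
      using AE_circle_measure by eventually_elim (use K assms in \<open>auto intro!: powr_mono2\<close>)
  qed measurable
qed simp

text \<open>The arguments of \<open>a\<close> and \<open>b\<close> can be absorbed into a rotation of \<open>u\<close>.\<close>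

lemma nn_integral_circle_linear_cong:
  fixes g :: "real \<Rightarrow> ennreal"
  assumes [measurable]: "g \<in> borel_measurable borel" and "cmod a = cmod a'" "cmod b = cmod b'"
  shows "(\<integral>\<^sup>+u. g (cmod (a + u * b)) \<partial>circle_measure) = (\<integral>\<^sup>+u. g (cmod (a' + u * b')) \<partial>circle_measure)"
proof -
  obtain v where v: "cmod v = 1" "a' = v * a"
  proof (cases "a = 0")
    case True
    then show ?thesis using assms(2) by (intro that[of 1]) auto
  next
    case False
    then show ?thesis using assms(2) by (intro that[of "a' / a"]) (auto simp: norm_divide)
  qed
  obtain w where w: "cmod w = 1" "b' = w * b"
  proof (cases "b = 0")
    case True
    then show ?thesis using assms(3) by (intro that[of 1]) auto
  next
    case False
    then show ?thesis using assms(3) by (intro that[of "b' / b"]) (auto simp: norm_divide)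
  qed
  have vn: "v \<noteq> 0" using v by auto
  have "cmod (a' + u * b') = cmod (a + (w / v * u) * b)" for u
  proof -
    have "a' + u * b' = v * (a + (w / v * u) * b)" using vn v w by (simp add: field_simps)
    then show ?thesis using v by (simp add: norm_mult)
  qed
  then show ?thesis
    using nn_integral_circle_rotate[of "\<lambda>u. g (cmod (a + u * b))" "w / v"] v w
    by (simp add: norm_divide)
qed

text \<open>The difference of the squares is \<open>((a - b) / 2)\<^sup>2 * (cmod (1 - u))\<^sup>2\<close>.\<close>

lemma cmod_one_add_le:
  assumes u: "cmod u = 1" and ab: "0 \<le> a" "0 \<le> b"
  shows "(a + b) / 2 * cmod (1 + u) \<le> cmod (of_real a + u * of_real b)"
proof -
  have "(cmod (of_real a + u * of_real b))\<^sup>2 - ((a + b) / 2 * cmod (1 + u))\<^sup>2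
      = ((a - b) / 2)\<^sup>2 * (cmod (1 - u))\<^sup>2"
  proof -
    have "(Re u)\<^sup>2 + (Im u)\<^sup>2 = 1" using u by (simp add: cmod_power2[symmetric])
    then show ?thesis
      unfolding power_mult_distrib cmod_power2
      by (simp add: power2_eq_square field_simps) algebra
  qed
  then have "((a + b) / 2 * cmod (1 + u))\<^sup>2 \<le> (cmod (of_real a + u * of_real b))\<^sup>2"
    using mult_nonneg_nonneg[OF zero_le_power2 zero_le_power2, of "(a - b) / 2" "cmod (1 - u)"]
    by linarith
  then show ?thesis by (rule power2_le_imp_le) simp
qed

text \<open>
  The bound on \<open>W\<close> gives \<open>cmod W * cmod (1 + u) \<le> cmod (cmod F + u * cmod H)\<close> for the images \<open>F\<close>
  and \<open>H\<close> of \<open>f\<close> under the operator and its dual. After integration over \<open>u\<close> the moduli inside may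
  be dropped, and for fixed \<open>u\<close> Arestov's inequality applies to the operator with multipliers
  \<open>\<nu> k + u * dual_mult n \<nu> k\<close>, whose value at \<open>k = 0\<close> supplies the factor on the right.
\<close>

lemma powr_integral_mean_le:
  assumes pres: "preserves_zero_free n (dual_mult n \<nu>)" and zf: "zero_free n f" and p: "p > 0"
    and W: "\<And>z. cmod z = 1 \<Longrightarrow> 2 * cmod (poly W z)
      \<le> cmod (poly (diag_op n \<nu> f) z) + cmod (poly (diag_op n (dual_mult n \<nu>) f) z)"
  shows "(\<integral>\<^sup>+z. ennreal (cmod (poly W z) powr p) \<partial>circle_measure)
      * (\<integral>\<^sup>+u. ennreal (cmod (1 + u) powr p) \<partial>circle_measure)
    \<le> (\<integral>\<^sup>+u. ennreal (cmod (\<nu> 0 + u * \<nu> n) powr p) \<partial>circle_measure)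
      * (\<integral>\<^sup>+z. ennreal (cmod (poly f z) powr p) \<partial>circle_measure)"
proof -
  define F where "F = diag_op n \<nu> f"
  define H where "H = diag_op n (dual_mult n \<nu>) f"
  define N where "N = (\<integral>\<^sup>+z. ennreal (cmod (poly f z) powr p) \<partial>circle_measure)"
  have "(\<integral>\<^sup>+z. ennreal (cmod (poly W z) powr p) \<partial>circle_measure)
      * (\<integral>\<^sup>+u. ennreal (cmod (1 + u) powr p) \<partial>circle_measure)
    = (\<integral>\<^sup>+z. (\<integral>\<^sup>+u. ennreal ((cmod (poly W z) * cmod (1 + u)) powr p) \<partial>circle_measure) \<partial>circle_measure)"
    by (simp add: powr_mult ennreal_mult' nn_integral_cmult nn_integral_multc)
  also have "\<dots> \<le> (\<integral>\<^sup>+z. (\<integral>\<^sup>+u. ennreal (cmod (poly F z + u * poly H z) powr p) \<partial>circle_measure) \<partial>circle_measure)"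
  proof (rule nn_integral_mono_AE, use AE_circle_measure in eventually_elim)
    fix z :: complex assume z: "cmod z = 1"
    let ?a = "cmod (poly F z)" and ?b = "cmod (poly H z)"
    have "(\<integral>\<^sup>+u. ennreal ((cmod (poly W z) * cmod (1 + u)) powr p) \<partial>circle_measure)
        \<le> (\<integral>\<^sup>+u. ennreal (cmod (of_real ?a + u * of_real ?b) powr p) \<partial>circle_measure)"
    proof (rule nn_integral_mono_AE, use AE_circle_measure in eventually_elim)
      fix u :: complex assume u: "cmod u = 1"
      have "cmod (poly W z) * cmod (1 + u) \<le> (?a + ?b) / 2 * cmod (1 + u)"
        using W[OF z] by (intro mult_right_mono) (auto simp: F_def H_def)
      also have "\<dots> \<le> cmod (of_real ?a + u * of_real ?b)" by (rule cmod_one_add_le[OF u]) auto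
      finally show "ennreal ((cmod (poly W z) * cmod (1 + u)) powr p)
          \<le> ennreal (cmod (of_real ?a + u * of_real ?b) powr p)"
        using p by (intro ennreal_leI powr_mono2) auto
    qed
    also have "\<dots> = (\<integral>\<^sup>+u. ennreal (cmod (poly F z + u * poly H z) powr p) \<partial>circle_measure)"
      by (rule nn_integral_circle_linear_cong[of "\<lambda>x. ennreal (x powr p)"]) auto
    finally show "(\<integral>\<^sup>+u. ennreal ((cmod (poly W z) * cmod (1 + u)) powr p) \<partial>circle_measure)
      \<le> (\<integral>\<^sup>+u. ennreal (cmod (poly F z + u * poly H z) powr p) \<partial>circle_measure)" .
  qed
  also have "\<dots> = (\<integral>\<^sup>+u. (\<integral>\<^sup>+z. ennreal (cmod (poly F z + u * poly H z) powr p) \<partial>circle_measure) \<partial>circle_measure)"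
    by (rule circle2.Fubini') measurable
  also have "\<dots> \<le> (\<integral>\<^sup>+u. ennreal (cmod (\<nu> 0 + u * cnj (\<nu> n)) powr p) * N \<partial>circle_measure)"
  proof (rule nn_integral_mono_AE, use AE_circle_measure in eventually_elim)
    fix u :: complex assume u: "cmod u = 1"
    let ?\<kappa> = "\<lambda>k. \<nu> k + u * dual_mult n \<nu> k"
    have eq: "poly (diag_op n ?\<kappa> f) z = poly F z + u * poly H z" for z
      unfolding F_def H_def poly_diag_op by (simp add: sum.distrib sum_distrib_left algebra_simps)
    consider "preserves_zero_free n ?\<kappa>" | "\<forall>f. degree f \<le> n \<longrightarrow> diag_op n ?\<kappa> f = 0"
      using preserves_or_annihilates[of n ?\<kappa>] diag_op_add_dual_zero_free[OF pres _ u] by blast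
    then have "(\<integral>\<^sup>+z. ennreal (cmod (poly (diag_op n ?\<kappa> f) z) powr p) \<partial>circle_measure)
        \<le> ennreal (cmod (?\<kappa> 0) powr p) * N"
    proof cases
      case 1
      then show ?thesis unfolding N_def by (rule arestov_inequality[OF _ zero_freeD(1)[OF zf] p])
    next
      case 2
      then have "diag_op n ?\<kappa> f = 0" using zero_freeD(1)[OF zf] by blast
      then show ?thesis by simp
    qed
    then show "(\<integral>\<^sup>+z. ennreal (cmod (poly F z + u * poly H z) powr p) \<partial>circle_measure)
        \<le> ennreal (cmod (\<nu> 0 + u * cnj (\<nu> n)) powr p) * N"
      unfolding eq by (simp add: dual_mult_def)
  qed
  also have "\<dots> = (\<integral>\<^sup>+u. ennreal (cmod (\<nu> 0 + u * cnj (\<nu> n)) powr p) \<partial>circle_measure) * N"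
    by (rule nn_integral_multc) measurable
  also have "(\<integral>\<^sup>+u. ennreal (cmod (\<nu> 0 + u * cnj (\<nu> n)) powr p) \<partial>circle_measure)
      = (\<integral>\<^sup>+u. ennreal (cmod (\<nu> 0 + u * \<nu> n) powr p) \<partial>circle_measure)"
    by (rule nn_integral_circle_linear_cong[of "\<lambda>x. ennreal (x powr p)"]) auto
  finally show ?thesis by (simp add: N_def)
qed

lemma circle_norm_linear_0:
  assumes "a \<noteq> 0 \<or> b \<noteq> 0"
  shows "circle_norm 0 [:a, b:] = max (cmod a) (cmod b)"
proof -
  have "[:a, b:] \<noteq> 0" using assms by auto
  moreover have "0 < max (cmod a) (cmod b)" using assms by (auto simp: less_max_iff_disj)
  ultimately show ?thesis using log_integral_linear(2)[OF assms] by (simp add: circle_norm_0)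
qed

lemma circle_norm_one_add_pos:
  assumes "0 \<le> p"
  shows "0 < circle_norm p [:1, 1:]"
proof (cases "p = 0")
  case True
  then show ?thesis by (simp add: circle_norm_linear_0)
next
  case False
  then have p: "p > 0" using assms by simp
  have "(\<integral>\<^sup>+z. ennreal (cmod (poly [:1, 1:] z) powr p) \<partial>circle_measure) \<noteq> 0"
  proof
    assume "(\<integral>\<^sup>+z. ennreal (cmod (poly [:1, 1:] z) powr p) \<partial>circle_measure) = 0"
    then have "AE z in circle_measure. ennreal (cmod (poly [:1, 1:] z) powr p) = 0"
      by (subst (asm) nn_integral_0_iff_AE) auto
    moreover have "AE z in circle_measure. poly [:1, 1 :: complex:] z \<noteq> 0"
      by (rule AE_circle_poly_nonzero) simp
    ultimately have "AE z in circle_measure. False"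
      by eventually_elim simp
    then show False by simp
  qed
  then have "0 < (LINT z|circle_measure. cmod (poly [:1, 1:] z) powr p)"
    unfolding nn_integral_circle_powr[OF p] by (simp add: ennreal_eq_0_iff)
  then show ?thesis using p by (simp add: circle_norm_pos)
qed

text \<open>
  For \<open>p = 0\<close> no averaging over \<open>u\<close> is needed: \<open>W\<close> is dominated by the image \<open>H\<close> under the dual,
  which has no zeros in the disc, so that \<open>circle_norm 0 H\<close> is the modulus of its constant term.
\<close>

lemma circle_norm_mean_le:
  assumes pres: "preserves_zero_free n (dual_mult n \<nu>)" and zf: "zero_free n f" and p: "p \<ge> 0"
    and W: "\<And>z. cmod z = 1 \<Longrightarrow> 2 * cmod (poly W z)
      \<le> cmod (poly (diag_op n \<nu> f) z) + cmod (poly (diag_op n (dual_mult n \<nu>) f) z)"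
  shows "circle_norm p W \<le> circle_norm p [:\<nu> 0, \<nu> n:] / circle_norm p [:1, 1:] * circle_norm p f"
proof (cases "p = 0")
  case True
  define H where "H = diag_op n (dual_mult n \<nu>) f"
  note \<nu>n = dual_constant_multiplier_le[OF pres]
  have H: "zero_free n H" unfolding H_def by (rule preserves_zero_freeD[OF pres zf])
  have "circle_norm 0 W \<le> cmod (\<nu> n) * cmod (poly f 0)"
  proof (cases "W = 0")
    case False
    have "(LINT z|circle_measure. ln (cmod (poly W z))) \<le> (LINT z|circle_measure. ln (cmod (poly H z)))"
    proof (intro integral_mono_AE integrable_log_poly False zero_freeD(3)[OF H])
      show "AE z in circle_measure. ln (cmod (poly W z)) \<le> ln (cmod (poly H z))"
        using AE_circle_measure AE_circle_poly_nonzero[OF False]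
      proof eventually_elim
        fix z :: complex assume z: "cmod z = 1" "poly W z \<noteq> 0"
        have "cmod (poly W z) \<le> cmod (poly H z)"
          using W[OF z(1)] diag_op_le_dual_circle[OF pres zf z(1)] by (simp add: H_def)
        then show "ln (cmod (poly W z)) \<le> ln (cmod (poly H z))"
          using z(2) by (intro ln_mono) auto
      qed
    qed
    also have "\<dots> = ln (cmod (poly H 0))" using jensen_zero_free[OF H] by simp
    also have "poly H 0 = cnj (\<nu> n) * poly f 0" by (simp add: H_def poly_0_diag_op dual_mult_def)
    finally have "circle_norm 0 W \<le> exp (ln (cmod (cnj (\<nu> n) * poly f 0)))"
      using False by (simp add: circle_norm_0)
    also have "\<dots> = cmod (\<nu> n) * cmod (poly f 0)"
      using \<nu>n zero_freeD(2)[OF zf, of 0] by (simp add: norm_mult)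
    finally show ?thesis .
  qed (simp add: circle_norm_def)
  moreover have "circle_norm 0 [:\<nu> 0, \<nu> n:] = cmod (\<nu> n)"
    using \<nu>n by (simp add: circle_norm_linear_0 max_absorb2)
  moreover have "circle_norm 0 [:1, 1:] = 1" by (simp add: circle_norm_linear_0)
  moreover have "circle_norm 0 f = cmod (poly f 0)"
    using jensen_zero_free[OF zf] zero_freeD(2)[OF zf, of 0] zero_freeD(3)[OF zf] by (simp add: circle_norm_0)
  ultimately show ?thesis using True by simp
next
  case False
  then have p: "p > 0" using assms by simp
  define I where "I Q = (LINT z|circle_measure. cmod (poly Q z) powr p)" for Q
  have nn: "(\<integral>\<^sup>+z. ennreal (cmod (poly Q z) powr p) \<partial>circle_measure) = ennreal (I Q)" for Q
    unfolding I_def by (rule nn_integral_circle_powr[OF p])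
  have I0: "0 \<le> I Q" for Q unfolding I_def by (intro Bochner_Integration.integral_nonneg) auto
  have norm: "circle_norm p Q = I Q powr (1 / p)" for Q
    using False by (simp add: I_def circle_norm_pos)
  have pos: "0 < I [:1, 1:]"
    using circle_norm_one_add_pos[of p] p I0[of "[:1, 1:]"] unfolding norm by (cases "I [:1, 1:] = 0") auto
  have "ennreal (I W) * ennreal (I [:1, 1:]) \<le> ennreal (I [:\<nu> 0, \<nu> n:]) * ennreal (I f)"
    using powr_integral_mean_le[OF pres zf p W] nn[of "[:1, 1:]"] nn[of "[:\<nu> 0, \<nu> n:]"] by (simp add: nn)
  then have "I W * I [:1, 1:] \<le> I [:\<nu> 0, \<nu> n:] * I f"
    by (simp add: I0 flip: ennreal_mult)
  then have "I W \<le> I [:\<nu> 0, \<nu> n:] / I [:1, 1:] * I f" using pos by (simp add: field_simps)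
  then have "I W powr (1 / p) \<le> (I [:\<nu> 0, \<nu> n:] / I [:1, 1:] * I f) powr (1 / p)"
    using p I0 by (intro powr_mono2) auto
  also have "\<dots> = I [:\<nu> 0, \<nu> n:] powr (1 / p) / I [:1, 1:] powr (1 / p) * I f powr (1 / p)"
    using I0 by (simp add: powr_mult powr_divide)
  finally show ?thesis unfolding norm .
qed

text \<open>The map \<open>z \<mapsto> z ^ n\<close> preserves the measure, and a rotation removes the arguments of the coefficients.\<close>

lemma circle_norm_binomial:
  assumes n: "n \<ge> 1" and ab: "cmod a = cmod a'" "cmod b = cmod b'"
  shows "circle_norm p (monom b n + [:a:]) = circle_norm p [:a', b':]"
proof -
  have Q0: "monom b n + [:a:] = 0 \<longleftrightarrow> a' = 0 \<and> b' = 0"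
  proof
    assume *: "monom b n + [:a:] = 0"
    have "coeff (monom b n + [:a:]) 0 = a" "coeff (monom b n + [:a:]) n = b"
      using n by (auto simp: coeff_pCons split: nat.split)
    with * ab show "a' = 0 \<and> b' = 0" by auto
  qed (use ab in auto)
  have poly: "poly (monom b n + [:a:]) z = a + z ^ n * b" for z
    by (simp add: poly_monom mult.commute)
  show ?thesis
  proof (cases "a' = 0 \<and> b' = 0")
    case True
    with Q0 show ?thesis by simp
  next
    case False
    show ?thesis
    proof (cases "p = 0")
      case True
      have "(LINT z|circle_measure. ln (cmod (a + z ^ n * b))) = (LINT z|circle_measure. ln (cmod (a + z * b)))"
        by (rule integral_circle_power[OF _ n]) measurable
      moreover have "(LINT z|circle_measure. ln (cmod (a + z * b))) = (LINT z|circle_measure. ln (cmod (a' + z * b')))"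
        using False ab by (subst (1 2) log_integral_linear(2)) auto
      ultimately show ?thesis using True False Q0 by (simp add: circle_norm_0 poly del: poly_add)
    next
      case p: False
      have "(LINT z|circle_measure. cmod (a + z ^ n * b) powr p) = (LINT z|circle_measure. cmod (a + z * b) powr p)"
        by (rule integral_circle_power[OF _ n]) measurable
      also have "\<dots> = (LINT z|circle_measure. cmod (a' + z * b') powr p)"
        using nn_integral_circle_linear_cong[of "\<lambda>x. ennreal (x powr p)", OF _ ab]
        by (simp add: integral_eq_nn_integral)
      finally show ?thesis using p by (simp add: circle_norm_pos poly del: poly_add)
    qed
  qed
qed

lemma circle_min_bounds:
  shows "0 \<le> circle_min f" and "cmod z = 1 \<Longrightarrow> circle_min f \<le> cmod (poly f z)"
proof -
  show "0 \<le> circle_min f" unfolding circle_min_def by (intro cINF_greatest) auto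
  show "cmod z = 1 \<Longrightarrow> circle_min f \<le> cmod (poly f z)"
    unfolding circle_min_def by (intro cINF_lower bdd_belowI[of _ 0]) auto
qed

lemma circle_min_binomial:
  assumes n: "n \<ge> 1" and ab: "cmod a = 1" "cmod b = 1"
  shows "circle_min (monom a n + [:b:]) = 0"
proof -
  have "cmod (- b / a) = 1" using ab by (simp add: norm_divide)
  then obtain \<psi> where \<psi>: "- b / a = cis \<psi>"
    using complex_unimodular_polar by (metis cis.code)
  have "cis (\<psi> / n) ^ n = - b / a" unfolding \<psi> using n by (auto simp: Complex.DeMoivre)
  then have "poly (monom a n + [:b:]) (cis (\<psi> / n)) = 0"
    using ab by (auto simp: poly_monom)
  with circle_min_bounds(2)[of "cis (\<psi> / n)" "monom a n + [:b:]"] circle_min_bounds(1)[of "monom a n + [:b:]"]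
  show ?thesis by simp
qed

theorem theorem1:
  fixes n :: nat and l0 l1 l2 \<alpha> \<delta> :: complex and p R :: real
  assumes "n \<ge> 1"
    and "admissible_B n l0 l1 l2"
    and "cmod \<alpha> \<le> 1" and "cmod \<delta> \<le> 1"
    and "0 \<le> p" and "R > 1"
  defines "\<Lambda> \<equiv> Lambda_B n l0 l1 l2"
  defines "lhs \<equiv> \<lambda>P. circle_norm p
      (op_B n l0 l1 l2 (P \<circ>\<^sub>p [:0, of_real R:]) - smult \<alpha> (op_B n l0 l1 l2 P)
       + [:\<delta> * of_real ((cmod (of_real R ^ n - \<alpha>) * cmod \<Lambda> - cmod (1 - \<alpha>) * cmod l0)
                        * circle_min P / 2):])"
  defines "rhs \<equiv> \<lambda>P. circle_norm p [:(1 - \<alpha>) * l0, (of_real R ^ n - \<alpha>) * \<Lambda>:]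
      / circle_norm p [:1, 1:] * circle_norm p P"
  shows "(\<forall>P. degree P \<le> n \<and> (\<forall>z. cmod z < 1 \<longrightarrow> poly P z \<noteq> 0) \<longrightarrow> lhs P \<le> rhs P)
    \<and> (\<forall>a b. cmod a = 1 \<and> cmod b = 1 \<longrightarrow> lhs (monom a n + [:b:]) = rhs (monom a n + [:b:]))"
proof -
  define \<nu> where "\<nu> k = mult_B n l0 l1 l2 k * (of_real R ^ k - \<alpha>)" for k
  have \<nu>0: "\<nu> 0 = (1 - \<alpha>) * l0" and \<nu>n: "\<nu> n = (of_real R ^ n - \<alpha>) * \<Lambda>"
    by (simp_all add: \<nu>_def mult_B_0 mult_B_degree \<Lambda>_def)
  have "dual_mult n \<nu> = (\<lambda>k. dual_mult n (mult_B n l0 l1 l2) k * dual_mult n (\<lambda>k. of_real R ^ k - \<alpha>) k)"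
    by (simp add: fun_eq_iff dual_mult_def \<nu>_def)
  then have pres: "preserves_zero_free n (dual_mult n \<nu>)"
    using preserves_zero_free_mult[OF preserves_zero_free_mult_B[OF assms(1,2)]
        preserves_zero_free_dilation_diff[OF assms(1,6,3)]] by simp
  define c where "c = cmod (\<nu> n) - cmod (\<nu> 0)"
  have c: "0 \<le> c" using dual_constant_multiplier_le(1)[OF pres] by (simp add: c_def)
  have lhs: "lhs P = circle_norm p (diag_op n \<nu> P + [:\<delta> * of_real (c * circle_min P / 2):])"
    if "degree P \<le> n" for P
    unfolding lhs_def op_B_dilation_diff[OF that] c_def \<nu>0 \<nu>n \<nu>_def[symmetric, abs_def] norm_mult ..
  show ?thesis
  proof (intro conjI allI impI)
    fix P assume "degree P \<le> n \<and> (\<forall>z. cmod z < 1 \<longrightarrow> poly P z \<noteq> 0)"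
    then have zf: "zero_free n P" by (simp add: zero_free_def)
    let ?W = "diag_op n \<nu> P + [:\<delta> * of_real (c * circle_min P / 2):]"
    have "circle_norm p ?W \<le> circle_norm p [:\<nu> 0, \<nu> n:] / circle_norm p [:1, 1:] * circle_norm p P"
    proof (rule circle_norm_mean_le[OF pres zf assms(5)])
      fix z :: complex assume z: "cmod z = 1"
      have "cmod (\<delta> * of_real (c * circle_min P / 2)) \<le> c * circle_min P / 2"
        using assms(4) c circle_min_bounds(1)[of P] by (simp add: norm_mult mult_left_le_one_le)
      then have "2 * cmod (poly ?W z) \<le> 2 * cmod (poly (diag_op n \<nu> P) z) + c * circle_min P"
        using norm_triangle_ineq[of "poly (diag_op n \<nu> P) z" "\<delta> * of_real (c * circle_min P / 2)"]
        by simp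
      moreover have "cmod (poly (diag_op n \<nu> P) z) + c * circle_min P
          \<le> cmod (poly (diag_op n (dual_mult n \<nu>) P) z)"
        using diag_op_add_min_le_dual[OF pres zf circle_min_bounds, of z] z by (simp add: c_def)
      ultimately show "2 * cmod (poly ?W z)
          \<le> cmod (poly (diag_op n \<nu> P) z) + cmod (poly (diag_op n (dual_mult n \<nu>) P) z)"
        by linarith
    qed
    then show "lhs P \<le> rhs P"
      unfolding lhs[OF zero_freeD(1)[OF zf]] rhs_def \<nu>0 \<nu>n .
  next
    fix a b :: complex assume ab: "cmod a = 1 \<and> cmod b = 1"
    let ?P = "monom a n + [:b:]"
    have deg: "degree ?P \<le> n" by (intro degree_add_le degree_monom_le) auto
    have "diag_op n \<nu> ?P = monom (\<nu> n * a) n + [:\<nu> 0 * b:]"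
      by (rule poly_eqI) (use assms(1) in \<open>auto simp: coeff_diag_op coeff_pCons split: nat.split\<close>)
    then have "lhs ?P = circle_norm p (monom (\<nu> n * a) n + [:\<nu> 0 * b:])"
      unfolding lhs[OF deg] using circle_min_binomial[OF assms(1)] ab by simp
    also have "\<dots> = circle_norm p [:\<nu> 0, \<nu> n:]"
      using ab by (intro circle_norm_binomial assms(1)) (auto simp: norm_mult)
    also have "circle_norm p ?P = circle_norm p [:1, 1:]"
      using ab by (intro circle_norm_binomial assms(1)) auto
    then have "circle_norm p [:\<nu> 0, \<nu> n:] = rhs ?P"
      using circle_norm_one_add_pos[OF assms(5)] by (simp add: rhs_def \<nu>0 \<nu>n)
    finally show "lhs ?P = rhs ?P" .
  qed
qed

end
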